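(* For all integers $n, r \geqslant 1$, $$\mathsf{D}(C^r_n) \leqslant r(n-1) + 1 + (c_r - r)\left(\frac{n}{P(n)}-1\right).$$
   Context: For an integer $n \geqslant 1$, $C_n$ denotes the cyclic group of order $n$ and $C_n^r$ the direct sum of $r$ copies of $C_n$. For a finite Abelian group $G$, $\exp(G)$ is its exponent. A sequence over $G$ is a finite (unordered, repetitions allowed) sequence of elements of $G$; it is zero-sum if the sum of its elements is $0$. The Davenport constant $\mathsf{D}(G)$ is the smallest integer $t \geqslant 1$ such that every sequence over $G$ of length at least $t$ contains a non-empty zero-sum subsequence. The invariant $\eta(G)$ is the smallest integer $t \geqslant 1$ such that every sequence over $G$ of length at least $t$ contains a non-empty zero-sum subsequence of length at most $\exp(G)$. By a theorem of Alon and Dubiner, for each integer $r \geqslant 1$ there is a constant $c > 0$ such that $\eta(C_n^r) \leqslant c(n-1)+1$ for all integers $n \geqslant 1$; $c_r$ denotes the smallest such constant, i.e. the smallest real number with $\eta(C_n^r) \leqslant c_r(n-1)+1$ for all $n \geqslant 1$. For an integer $n \geqslant 1$, $P(n)$ denotes the greatest prime power dividing $n$, with the convention $P(1)=1$. *)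

theory Defs
  imports
    "HOL-Algebra.Product_Groups"
    "HOL-Algebra.FiniteProduct"
    "HOL-Library.Multiset"
    "HOL-Number_Theory.Prime_Powers"
    Complex_Main
begin

text \<open>
  Finite abelian groups are groups in the sense of HOL-Algebra, hence written multiplicatively;
  a sequence over \<open>G\<close> is a finite multiset of elements of the carrier, and its subsequences are its
  sub-multisets.
\<close>

definition sequence_over :: "('a, 'b) monoid_scheme \<Rightarrow> 'a multiset \<Rightarrow> bool"
  where "sequence_over G S \<longleftrightarrow> set_mset S \<subseteq> carrier G"

text \<open>
  The library's multiset sums need a type-class group and so do not apply to a group on a carrier
  set. We use \<^const>\<open>finprod\<close> over the distinct terms, each raised to its multiplicity.
\<close>

definition seq_sum :: "('a, 'b) monoid_scheme \<Rightarrow> 'a multiset \<Rightarrow> 'a"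
  where "seq_sum G S = finprod G (\<lambda>x. x [^]\<^bsub>G\<^esub> count S x) (set_mset S)"

definition zero_sum :: "('a, 'b) monoid_scheme \<Rightarrow> 'a multiset \<Rightarrow> bool"
  where "zero_sum G S \<longleftrightarrow> seq_sum G S = \<one>\<^bsub>G\<^esub>"

definition group_exp :: "('a, 'b) monoid_scheme \<Rightarrow> nat"
  where "group_exp G = (LEAST e. e \<ge> 1 \<and> (\<forall>x \<in> carrier G. x [^]\<^bsub>G\<^esub> e = \<one>\<^bsub>G\<^esub>))"

definition davenport :: "('a, 'b) monoid_scheme \<Rightarrow> nat"
  where "davenport G = (LEAST t. t \<ge> 1 \<and>
    (\<forall>S. sequence_over G S \<and> size S \<ge> t \<longrightarrow>
      (\<exists>T. T \<subseteq># S \<and> T \<noteq> {#} \<and> zero_sum G T)))"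

definition eta :: "('a, 'b) monoid_scheme \<Rightarrow> nat"
  where "eta G = (LEAST t. t \<ge> 1 \<and>
    (\<forall>S. sequence_over G S \<and> size S \<ge> t \<longrightarrow>
      (\<exists>T. T \<subseteq># S \<and> T \<noteq> {#} \<and> zero_sum G T \<and> size T \<le> group_exp G)))"

text \<open>
  The group \<open>C\<^sub>n\<^sup>r\<close>. As the index set is finite, the direct product is also the direct sum. Only
  \<open>n \<ge> 1\<close> is meaningful, since \<^term>\<open>integer_mod_group 0\<close> is the infinite cyclic group.
\<close>

definition cyclic_power :: "nat \<Rightarrow> nat \<Rightarrow> (nat \<Rightarrow> int) monoid"
  where "cyclic_power n r = product_group {..<r} (\<lambda>_. integer_mod_group n)"

text \<open>
  That the following minimum exists is a theorem of Alon and Dubiner: it amounts to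
  \<^term>\<open>eta (cyclic_power n r)\<close> growing at most linearly in \<open>n\<close>.
\<close>

definition c_const :: "nat \<Rightarrow> real"
  where "c_const r =
    (LEAST c. \<forall>n \<ge> 1. real (eta (cyclic_power n r)) \<le> c * (real n - 1) + 1)"

definition greatest_primepow :: "nat \<Rightarrow> nat"
  where "greatest_primepow n = (if n = 1 then 1 else Max (primepow_factors n))"

end

theory Submission
  imports Defs
begin

text \<open>
  Write \<open>n = m q\<close> with \<open>q = P(n)\<close>. Since \<open>\<eta>(C\<^sub>m\<^sup>r) \<le> c\<^sub>r (m - 1) + 1\<close>, a sequence over \<open>C\<^sub>n\<^sup>r\<close> of length at least
  \<open>r (q - 1) m + c\<^sub>r (m - 1) + 1\<close> contains \<open>r (q - 1) + 1\<close> disjoint short subsequences whose sums lie in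
  \<open>m C\<^sub>n\<^sup>r\<close>, which is isomorphic to \<open>C\<^sub>q\<^sup>r\<close>, and Olson's theorem \<open>D(C\<^sub>q\<^sup>r) = r (q - 1) + 1\<close> for the prime power \<open>q\<close>
  combines some of these into a zero-sum subsequence.

  The constant \<open>c\<^sub>r\<close> is a minimum, so its defining inequality is only available once some linear bound on
  \<open>\<eta>(C\<^sub>n\<^sup>r)\<close> is known. The same extraction argument reduces this to prime \<open>n = p\<close>, where we follow Alon and
  Dubiner. By induction on the dimension, one may assume that no affine hyperplane contains many terms. Then
  sets of sums of equally many terms are grown, by using up a pair of terms at a time, until they fill more
  than half of \<open>F\<^sub>p\<^sup>r\<close>: small sets grow because suitable translates hardly meet, large ones by a spectral gap. Two
  such sets from disjoint sets of terms have a sum covering \<open>F\<^sub>p\<^sup>r\<close>, which gives a zero-sum subsequence of length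
  exactly \<open>p\<close>.
\<close>

section \<open>Translations of sets of vectors modulo a prime\<close>

locale prime_vectors =
  fixes p :: nat and I :: "nat set"
  assumes prime_p: "prime p" and finite_I: "finite I"
begin

lemma p_pos: "0 < p" "0 < int p"
  using prime_p prime_gt_0_nat by auto

text \<open>Residue vectors are extensional functions, so that congruence on \<open>I\<close>
  becomes equality of functions.\<close>

definition box :: "(nat \<Rightarrow> int) set"
  where "box = (\<Pi>\<^sub>E i\<in>I. {0..<int p})"

definition red :: "(nat \<Rightarrow> int) \<Rightarrow> nat \<Rightarrow> int"
  where "red v = (\<lambda>i\<in>I. v i mod int p)"

definition shift :: "(nat \<Rightarrow> int) \<Rightarrow> (nat \<Rightarrow> int) set \<Rightarrow> (nat \<Rightarrow> int) set"
  where "shift v Y = (\<lambda>y. red (\<lambda>i. y i + v i)) ` Y"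

text \<open>The gain in size when a translate is adjoined to \<open>Y\<close>. Its subadditivity in
  \<open>v\<close> ties the gain of multiples and combinations to that of single vectors.\<close>

definition new :: "(nat \<Rightarrow> int) \<Rightarrow> (nat \<Rightarrow> int) set \<Rightarrow> nat"
  where "new v Y = card (shift v Y - Y)"

definition ip :: "(nat \<Rightarrow> int) \<Rightarrow> (nat \<Rightarrow> int) \<Rightarrow> int"
  where "ip u v = (\<Sum>i\<in>I. u i * v i)"

lemma finite_box: "finite box"
  unfolding box_def using finite_I by (intro finite_PiE) auto

lemma card_box: "card box = p ^ card I"
  unfolding box_def using finite_I by (simp add: card_PiE)

lemma finite_subset_box: "Y \<subseteq> box \<Longrightarrow> finite Y"
  using finite_box finite_subset by blast

lemma red_in_box: "red v \<in> box"
  unfolding red_def box_def using p_pos by auto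

lemma red_apply: "i \<in> I \<Longrightarrow> red v i = v i mod int p"
  by (simp add: red_def)

lemma red_eq_iff: "red v = red w \<longleftrightarrow> (\<forall>i\<in>I. int p dvd v i - w i)"
  unfolding red_def restrict_def fun_eq_iff by (auto simp: mod_eq_dvd_iff)

lemma red_box: "y \<in> box \<Longrightarrow> red y = y"
  unfolding red_def box_def by (auto simp: fun_eq_iff PiE_iff extensional_def)

lemma box_eqI:
  assumes "x \<in> box" "y \<in> box" "\<And>i. i \<in> I \<Longrightarrow> int p dvd x i - y i"
  shows "x = y"
  using assms red_box red_eq_iff by metis

lemma red_red_add: "red (\<lambda>i. red x i + y i) = red (\<lambda>i. x i + y i)"
  by (auto simp: red_def fun_eq_iff mod_add_left_eq)

lemma shift_subset_box: "shift v Y \<subseteq> box"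
  unfolding shift_def using red_in_box by blast

lemma shift_shift: "shift w (shift v Y) = shift (\<lambda>i. v i + w i) Y"
  unfolding shift_def image_image
  by (simp add: red_red_add add.assoc)

lemma shift_Un: "shift v (Y \<union> Z) = shift v Y \<union> shift v Z"
  unfolding shift_def by blast

lemma inj_on_shift: "inj_on (\<lambda>y. red (\<lambda>i. y i + v i)) box"
  by (rule inj_onI) (auto intro!: box_eqI simp: red_eq_iff)

lemma card_shift: "Y \<subseteq> box \<Longrightarrow> card (shift v Y) = card Y"
  unfolding shift_def using inj_on_shift by (intro card_image) (rule inj_on_subset)

lemma bij_shift: "bij_betw (\<lambda>y. red (\<lambda>i. y i + v i)) box box"
  unfolding bij_betw_def
  using inj_on_shift card_subset_eq[OF finite_box shift_subset_box[of v box]] card_shift[of box v]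
  by (simp add: shift_def)

lemma shift_cong: "red v = red w \<Longrightarrow> shift v Y = shift w Y"
  unfolding shift_def by (intro image_cong) (auto simp: red_eq_iff)

lemma new_cong: "red v = red w \<Longrightarrow> new v Y = new w Y"
  unfolding new_def by (simp add: shift_cong[of v w])

lemma new_red: "new (red v) Y = new v Y"
  by (rule new_cong) (simp add: red_box red_in_box)

lemma new_zero: "Y \<subseteq> box \<Longrightarrow> new (\<lambda>_. 0) Y = 0"
  unfolding new_def shift_def using red_box by (auto simp: subset_iff)

lemma card_shift_Int: "Y \<subseteq> box \<Longrightarrow> card (shift v Y \<inter> Y) + new v Y = card Y"
  unfolding new_def
  using card_shift[of Y v] card_Int_Diff[of "shift v Y" Y] finite_subset_box shift_subset_box
  by metis

text \<open>A point of the translate by \<open>v + w\<close> outside \<open>Y\<close> either comes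
  from a point already outside \<open>Y\<close> after moving by \<open>v\<close>, or is a new point
  of the translate by \<open>w\<close>.\<close>

lemma new_add:
  assumes "Y \<subseteq> box"
  shows "new (\<lambda>i. v i + w i) Y \<le> new v Y + new w Y"
proof -
  have "shift w (shift v Y) \<subseteq> shift w (shift v Y - Y) \<union> shift w Y"
    unfolding shift_def by auto
  then have "shift (\<lambda>i. v i + w i) Y - Y \<subseteq> shift w (shift v Y - Y) \<union> (shift w Y - Y)"
    by (auto simp: shift_shift)
  then have "new (\<lambda>i. v i + w i) Y \<le> card (shift w (shift v Y - Y)) + new w Y"
    unfolding new_def
    by (meson card_mono card_Un_le finite_UnI finite_Diff finite_subset_box shift_subset_box le_trans)
  moreover have "card (shift w (shift v Y - Y)) = new v Y"
    unfolding new_def by (rule card_shift) (use shift_subset_box in blast)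
  ultimately show ?thesis by simp
qed

lemma new_mult:
  assumes "Y \<subseteq> box"
  shows "new (\<lambda>i. int j * v i) Y \<le> j * new v Y"
proof (induction j)
  case 0
  then show ?case using new_zero[OF assms] by simp
next
  case (Suc j)
  have "new (\<lambda>i. int (Suc j) * v i) Y \<le> new (\<lambda>i. int j * v i) Y + new v Y"
    using new_add[OF assms, of "\<lambda>i. int j * v i" v] by (simp add: algebra_simps)
  with Suc show ?case by simp
qed

text \<open>A point of \<open>Y\<close> together with its translate determines the translation, so
  the overlaps over all of \<open>W\<close> count distinct pairs in
  \<open>Y \<times> Y\<close>.\<close>

lemma sum_card_shift_Int_le:
  assumes "W \<subseteq> box" "Y \<subseteq> box"
  shows "(\<Sum>w\<in>W. card (shift w Y \<inter> Y)) \<le> card Y * card Y"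
proof -
  have fin: "finite W" "finite Y" using assms finite_subset_box by auto
  let ?A = "SIGMA w:W. {y \<in> Y. red (\<lambda>i. y i + w i) \<in> Y}"
  have inj: "inj_on (\<lambda>y. red (\<lambda>i. y i + w i)) Y" for w
    using inj_on_shift assms inj_on_subset by blast
  have "card (shift w Y \<inter> Y) = card {y \<in> Y. red (\<lambda>i. y i + w i) \<in> Y}" for w
  proof -
    have "shift w Y \<inter> Y = (\<lambda>y. red (\<lambda>i. y i + w i)) ` {y \<in> Y. red (\<lambda>i. y i + w i) \<in> Y}"
      unfolding shift_def by auto
    then show ?thesis
      using card_image[OF inj_on_subset[OF inj]] by simp
  qed
  then have "(\<Sum>w\<in>W. card (shift w Y \<inter> Y)) = card ?A"
    using fin by simp
  also have "card ?A = card ((\<lambda>(w, y). (y, red (\<lambda>i. y i + w i))) ` ?A)"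
  proof (rule card_image[symmetric])
    have "w = w'" if "w \<in> W" "w' \<in> W" "red (\<lambda>i. y i + w i) = red (\<lambda>i. y i + w' i)" for w w' y
      using that assms by (intro box_eqI) (auto simp: red_eq_iff)
    then show "inj_on (\<lambda>(w, y). (y, red (\<lambda>i. y i + w i))) ?A"
      by (auto simp: inj_on_def)
  qed
  also have "\<dots> \<le> card (Y \<times> Y)"
    using fin by (intro card_mono) auto
  finally show ?thesis by (simp add: card_cartesian_product)
qed

section \<open>The pairing of vectors modulo \<open>p\<close> and growth of small sets\<close>

lemma ip_add: "ip u (\<lambda>i. v i + w i) = ip u v + ip u w"
  by (simp add: ip_def algebra_simps sum.distrib)

lemma ip_diff: "ip u (\<lambda>i. v i - w i) = ip u v - ip u w"
  by (simp add: ip_def algebra_simps sum_subtractf)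

lemma ip_diff_left: "ip (\<lambda>i. u i - v i) w = ip u w - ip v w"
  by (simp add: ip_def algebra_simps sum_subtractf)

lemma ip_add_left: "ip (\<lambda>i. u i + v i) w = ip u w + ip v w"
  by (simp add: ip_def algebra_simps sum.distrib)

lemma ip_mult: "ip u (\<lambda>i. c * v i) = c * ip u v"
  by (simp add: ip_def algebra_simps sum_distrib_left)

lemma ip_red: "int p dvd ip u (red v) - ip u v"
proof -
  have "ip u (red v) - ip u v = (\<Sum>i\<in>I. u i * (v i mod int p - v i))"
    by (simp add: ip_def red_def algebra_simps sum_subtractf)
  also have "int p dvd \<dots>"
    by (intro dvd_sum dvd_mult) (simp add: mod_eq_dvd_iff[symmetric])
  finally show ?thesis .
qed

lemma ip_commute: "ip u v = ip v u"
  by (simp add: ip_def mult.commute)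

text \<open>
  Combinations of few vectors whose coefficients range over \<open>{0..<L}\<close>, kept independent by taking
  each new vector outside the hyperplane \<open>ip u = 0\<close>, where the pigeonhole principle provides a
  nonzero \<open>u\<close> orthogonal to all vectors used so far.
\<close>

lemma combinations:
  fixes v :: "'x \<Rightarrow> nat \<Rightarrow> int"
  assumes spanning: "\<And>u. \<exists>i\<in>I. \<not> int p dvd u i \<Longrightarrow> \<exists>x\<in>R. \<not> int p dvd ip u (v x)"
    and "L \<le> p" "Y \<subseteq> box" and M: "\<And>x. x \<in> R \<Longrightarrow> new (v x) Y \<le> M"
    and "k \<le> card I"
  shows "\<exists>W X. W \<subseteq> box \<and> card W = L ^ k \<and> finite X \<and> card X \<le> k \<and>
    (\<forall>u. (\<forall>x\<in>X. int p dvd ip u (v x)) \<longrightarrow> (\<forall>w\<in>W. int p dvd ip u w)) \<and>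
    (\<forall>w\<in>W. new w Y \<le> k * L * M)"
  using \<open>k \<le> card I\<close>
proof (induction k)
  case 0
  have "new (red (\<lambda>_. 0)) Y = 0"
    using new_zero[OF \<open>Y \<subseteq> box\<close>] by (simp add: new_red)
  moreover have "int p dvd ip u (red (\<lambda>_. 0))" for u
    using ip_red[of u "\<lambda>_. 0"] by (simp add: ip_def)
  ultimately show ?case
    using red_in_box by (intro exI[of _ "{red (\<lambda>_. 0)}"] exI[of _ "{}"]) auto
next
  case (Suc k)
  then obtain W X where W: "W \<subseteq> box" "card W = L ^ k" and X: "finite X" "card X \<le> k"
    and orth: "\<And>u w. (\<forall>x\<in>X. int p dvd ip u (v x)) \<Longrightarrow> w \<in> W \<Longrightarrow> int p dvd ip u w"
    and newW: "\<And>w. w \<in> W \<Longrightarrow> new w Y \<le> k * L * M"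
    by (metis Suc_leD)
  let ?g = "\<lambda>u. \<lambda>x\<in>X. ip u (v x) mod int p"
  have "?g ` box \<subseteq> (\<Pi>\<^sub>E x\<in>X. {0..<int p})"
    using p_pos by auto
  then have "card (?g ` box) \<le> card (\<Pi>\<^sub>E x\<in>X. {0..<int p})"
    using X by (intro card_mono finite_PiE) auto
  also have "\<dots> = p ^ card X" using X by (simp add: card_PiE)
  also have "\<dots> < card box"
    unfolding card_box using X Suc.prems prime_gt_1_nat[OF prime_p]
    by (intro power_strict_increasing) auto
  finally have "\<not> inj_on ?g box" by (rule pigeonhole)
  then obtain a b where ab: "a \<in> box" "b \<in> box" "a \<noteq> b" "?g a = ?g b"
    by (auto simp: inj_on_def)
  define u where "u = (\<lambda>i. a i - b i)"
  have u0: "\<exists>i\<in>I. \<not> int p dvd u i"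
    using ab box_eqI unfolding u_def by blast
  have uX: "int p dvd ip u (v x)" if "x \<in> X" for x
    using fun_cong[OF ab(4), of x] that by (simp add: u_def ip_diff_left mod_eq_dvd_iff)
  obtain x where x: "x \<in> R" "\<not> int p dvd ip u (v x)"
    using spanning[OF u0] by blast
  let ?f = "\<lambda>(w, j). red (\<lambda>i. w i + int j * v x i)"
  let ?W = "?f ` (W \<times> {..<L})"
  have "inj_on ?f (W \<times> {..<L})"
  proof (rule inj_onI, clarify)
    fix w j w' j'
    assume A: "w \<in> W" "w' \<in> W" "j < L" "j' < L"
      and eq: "red (\<lambda>i. w i + int j * v x i) = red (\<lambda>i. w' i + int j' * v x i)"
    \<comment> \<open>Pairing with \<open>u\<close> kills the elements of \<open>W\<close> modulo
      \<open>p\<close>, so only \<open>(j - j') * ip u (v x)\<close> remains. Its second factor is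
      invertible and \<open>L \<le> p\<close>, which forces \<open>j = j'\<close>.\<close>
    have "int p dvd ip u (\<lambda>i. w i + int j * v x i) - ip u (\<lambda>i. w' i + int j' * v x i)"
      using dvd_diff[OF ip_red[of u "\<lambda>i. w' i + int j' * v x i"] ip_red[of u "\<lambda>i. w i + int j * v x i"]]
      unfolding eq by simp
    then have "int p dvd (ip u w - ip u w') + (int j - int j') * ip u (v x)"
      by (simp add: ip_add ip_mult algebra_simps)
    then have "int p dvd (int j - int j') * ip u (v x)"
      using dvd_diff[OF orth[of u w] orth[of u w']] uX A by (simp add: dvd_add_right_iff)
    then have "int p dvd int j - int j'"
      using x prime_p by (simp add: prime_dvd_mult_iff)
    moreover have "\<bar>int j - int j'\<bar> < int p" using A \<open>L \<le> p\<close> by auto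
    ultimately have "j = j'"
      using dvd_imp_le_int[of "int j - int j'" "int p"] by fastforce
    moreover from this have "w = w'"
      using eq A W by (intro box_eqI) (auto simp: red_eq_iff)
    ultimately show "w = w' \<and> j = j'" by simp
  qed
  then have "card ?W = L ^ Suc k"
    using W by (simp add: card_image card_cartesian_product)
  moreover have "?W \<subseteq> box" using red_in_box by auto
  moreover have "finite (insert x X)" "card (insert x X) \<le> Suc k"
    using X by (auto simp: card_insert_if)
  moreover have "int p dvd ip u' w"
    if *: "\<forall>x\<in>insert x X. int p dvd ip u' (v x)" and w: "w \<in> ?W" for u' w
  proof -
    obtain w0 j where w0: "w0 \<in> W" "w = red (\<lambda>i. w0 i + int j * v x i)" using w by auto
    have "int p dvd ip u' (\<lambda>i. w0 i + int j * v x i)"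
      using * orth[of u' w0] w0 by (auto simp: ip_add ip_mult)
    from dvd_add[OF ip_red[of u' "\<lambda>i. w0 i + int j * v x i"] this]
    show ?thesis using w0 by simp
  qed
  moreover have "new w Y \<le> Suc k * L * M" if w: "w \<in> ?W" for w
  proof -
    obtain w0 j where w0: "w0 \<in> W" "w = red (\<lambda>i. w0 i + int j * v x i)" "j < L" using w by auto
    have "new w Y \<le> new w0 Y + new (\<lambda>i. int j * v x i) Y"
      using w0 new_add[OF \<open>Y \<subseteq> box\<close>] by (simp add: new_red)
    also have "\<dots> \<le> k * L * M + j * new (v x) Y"
      using newW[OF w0(1)] new_mult[OF \<open>Y \<subseteq> box\<close>] by (intro add_mono)
    also have "\<dots> \<le> k * L * M + L * M"
      using w0 M[OF x(1)] by (intro add_mono mult_mono) auto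
    finally show ?thesis by (simp add: algebra_simps)
  qed
  ultimately show ?case
    by (intro exI[of _ ?W] exI[of _ "insert x X"] conjI ballI allI impI) assumption+
qed

text \<open>Average over the \<open>L ^ card I\<close> combinations: the overlaps sum to at most
  \<open>card Y ^ 2\<close>, so the mean gain is at least half of \<open>card Y\<close>. No
  combination gains more than \<open>card I * L * M\<close>, which bounds the best single gain
  \<open>M\<close> from below.\<close>

lemma growth_small:
  fixes v :: "'x \<Rightarrow> nat \<Rightarrow> int"
  assumes spanning: "\<And>u. \<exists>i\<in>I. \<not> int p dvd u i \<Longrightarrow> \<exists>x\<in>R. \<not> int p dvd ip u (v x)"
    and "L \<le> p" "0 < L" "Y \<subseteq> box" "2 * card Y \<le> L ^ card I" "finite R" "R \<noteq> {}"
  shows "\<exists>x\<in>R. card Y \<le> 2 * card I * L * new (v x) Y"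
proof -
  define M where "M = Max ((\<lambda>x. new (v x) Y) ` R)"
  have M: "new (v x) Y \<le> M" if "x \<in> R" for x
    unfolding M_def using that assms by (intro Max_ge) auto
  have "M \<in> (\<lambda>x. new (v x) Y) ` R"
    unfolding M_def using assms by (intro Max_in) auto
  then obtain x where x: "x \<in> R" "new (v x) Y = M" by auto
  obtain W where W: "W \<subseteq> box" "card W = L ^ card I"
    and newW: "\<And>w. w \<in> W \<Longrightarrow> new w Y \<le> card I * L * M"
    using combinations[OF spanning \<open>L \<le> p\<close> \<open>Y \<subseteq> box\<close> M order_refl] by blast
  have "L ^ card I * card Y = (\<Sum>w\<in>W. card (shift w Y \<inter> Y) + new w Y)"
    using card_shift_Int[OF \<open>Y \<subseteq> box\<close>] W by simp
  also have "\<dots> \<le> card Y * card Y + L ^ card I * (card I * L * M)"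
    unfolding sum.distrib
    using sum_card_shift_Int_le[OF W(1) \<open>Y \<subseteq> box\<close>] sum_bounded_above[of W "\<lambda>w. new w Y", OF newW] W
    by (intro add_mono) auto
  finally have "2 * (L ^ card I * card Y) \<le> 2 * card Y * card Y + 2 * (L ^ card I * (card I * L * M))"
    by simp
  also have "2 * card Y * card Y \<le> L ^ card I * card Y"
    using assms by (intro mult_right_mono) auto
  finally have "L ^ card I * card Y \<le> L ^ card I * (2 * card I * L * M)"
    by (simp add: algebra_simps)
  then have "card Y \<le> 2 * card I * L * M"
    using \<open>0 < L\<close> by simp
  then show ?thesis using x by auto
qed

end

section \<open>Growth from the spectral gap\<close>

text \<open>Up to \<open>pi / 3\<close> the cosine is at least one half, so
  \<open>sin x - x / 2\<close> is nondecreasing; beyond that point the sine is at least one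
  half.\<close>

lemma sin_ge_div_pi:
  fixes x :: real
  assumes "0 \<le> x" "x \<le> pi / 2"
  shows "x / pi \<le> sin x"
proof (cases "x \<le> pi / 3")
  case True
  have "sin (0 :: real) - 0 / 2 \<le> sin x - x / 2"
  proof (rule DERIV_nonneg_imp_nondecreasing[OF \<open>0 \<le> x\<close>])
    fix y assume y: "0 \<le> y" "y \<le> x"
    have "cos (pi / 3) \<le> cos y"
      using y True by (intro cos_monotone_0_pi_le) auto
    then have "0 \<le> cos y - 1 / 2" by (simp add: cos_60)
    moreover have "((\<lambda>x. sin x - x / 2) has_real_derivative cos y - 1 / 2) (at y)"
      by (auto intro!: derivative_eq_intros)
    ultimately show "\<exists>z. ((\<lambda>x. sin x - x / 2) has_real_derivative z) (at y) \<and> 0 \<le> z" by blast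
  qed
  moreover have "x / pi \<le> x / 2"
    using assms pi_ge_two by (intro divide_left_mono) auto
  ultimately show ?thesis unfolding sin_zero by linarith
next
  case False
  have "sin (pi / 6) \<le> sin x"
    using assms False by (intro sin_monotone_2pi_le) auto
  moreover have "x / pi \<le> 1 / 2" using assms by (simp add: field_simps)
  ultimately show ?thesis unfolding sin_30 by linarith
qed

lemma sin_ge_div_pi':
  fixes x \<alpha> :: real
  assumes "0 \<le> \<alpha>" "\<alpha> \<le> x" "x \<le> pi - \<alpha>"
  shows "\<alpha> / pi \<le> sin x"
proof (cases "x \<le> pi / 2")
  case True
  have "\<alpha> / pi \<le> x / pi" using assms by (simp add: divide_right_mono)
  with True assms sin_ge_div_pi[of x] show ?thesis by simp
next
  case False
  have "\<alpha> / pi \<le> (pi - x) / pi" using assms by (intro divide_right_mono) auto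
  with False assms sin_ge_div_pi[of "pi - x"] show ?thesis by simp
qed

context prime_vectors
begin

section \<open>Additive characters of the vectors modulo \<open>p\<close>\<close>

definition chi :: "int \<Rightarrow> complex"
  where "chi a = cis (2 * pi * of_int a / real p)"

lemma chi_add: "chi (a + b) = chi a * chi b"
  by (simp add: chi_def cis_mult add_divide_distrib algebra_simps)

lemma chi_minus: "chi (- a) = cnj (chi a)"
  by (simp add: chi_def cis_cnj)

lemma chi_zero: "chi 0 = 1"
  by (simp add: chi_def)

lemma norm_chi: "cmod (chi a) = 1"
  by (simp add: chi_def)

lemma chi_mult: "chi (int j * a) = chi a ^ j"
  by (induction j) (simp_all add: chi_zero chi_add algebra_simps)

lemma chi_eq_1_iff: "chi a = 1 \<longleftrightarrow> int p dvd a"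
proof
  assume "int p dvd a"
  then obtain k where "a = int p * k" by blast
  then show "chi a = 1"
    using p_pos by (simp add: chi_def complex_eq_iff cos_int_2pin[unfolded mult.assoc] sin_int_2pin[unfolded mult.assoc])
next
  assume "chi a = 1"
  then have "cos (2 * pi * of_int a / real p) = 1"
    unfolding chi_def by (metis cis.sel(1) one_complex.sel(1))
  then obtain k :: int where "2 * pi * of_int a / real p = of_int k * 2 * pi"
    by (auto simp: cos_one_2pi_int)
  then have "real_of_int a = of_int (k * int p)"
    using p_pos by (simp add: field_simps)
  then have "a = k * int p" by (simp only: of_int_eq_iff)
  then show "int p dvd a" by simp
qed

lemma chi_cong: "int p dvd a - b \<Longrightarrow> chi a = chi b"
  using chi_add[of "a - b" b] chi_eq_1_iff[of "a - b"] by simp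

text \<open>If \<open>w i\<close> is not divisible by \<open>p\<close>, moving \<open>u\<close> by
  the \<open>i\<close>-th unit vector permutes the box and multiplies the sum by
  \<open>chi (w i)\<close>, which differs from 1.\<close>

lemma orthogonality:
  "(\<Sum>u\<in>box. chi (ip u w)) = (if \<forall>i\<in>I. int p dvd w i then of_nat (p ^ card I) else 0)"
proof (cases "\<forall>i\<in>I. int p dvd w i")
  case True
  then have "chi (ip u w) = 1" for u
    unfolding chi_eq_1_iff ip_def by (intro dvd_sum dvd_mult) auto
  with True show ?thesis by (simp add: card_box)
next
  case False
  then obtain i where i: "i \<in> I" "\<not> int p dvd w i" by blast
  define e :: "nat \<Rightarrow> int" where "e = (\<lambda>k. if k = i then 1 else 0)"
  have ipe: "ip e w = w i"
    unfolding ip_def e_def using i finite_I by (simp add: if_distrib[of "\<lambda>c. c * _"] cong: if_cong)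
  have "(\<Sum>u\<in>box. chi (ip u w)) = (\<Sum>u\<in>box. chi (ip (red (\<lambda>k. u k + e k)) w))"
    by (rule sum.reindex_bij_betw[OF bij_shift, symmetric])
  also have "\<dots> = (\<Sum>u\<in>box. chi (w i) * chi (ip u w))"
  proof (rule sum.cong[OF refl])
    fix u
    have "chi (ip (red (\<lambda>k. u k + e k)) w) = chi (ip (\<lambda>k. u k + e k) w)"
      using ip_red[of w "\<lambda>k. u k + e k"] by (intro chi_cong) (simp add: ip_commute)
    then show "chi (ip (red (\<lambda>k. u k + e k)) w) = chi (w i) * chi (ip u w)"
      by (simp add: ip_add_left ipe chi_add)
  qed
  finally have "(1 - chi (w i)) * (\<Sum>u\<in>box. chi (ip u w)) = 0"
    by (simp add: sum_distrib_left[symmetric] left_diff_distrib)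
  moreover have "chi (w i) \<noteq> 1" using i chi_eq_1_iff by blast
  ultimately show ?thesis using False by auto
qed

text \<open>The squared modulus of the Fourier coefficient at \<open>u\<close> of the indicator
  function of \<open>Y\<close>.\<close>

definition spectrum :: "(nat \<Rightarrow> int) set \<Rightarrow> (nat \<Rightarrow> int) \<Rightarrow> real"
  where "spectrum Y u = (cmod (\<Sum>y\<in>Y. chi (ip u y)))\<^sup>2"

lemma spectrum_nonneg: "0 \<le> spectrum Y u"
  by (simp add: spectrum_def)

text \<open>The autocorrelation of \<open>Y\<close> is the Fourier transform of its power spectrum:
  after expanding the square, orthogonality leaves only the pairs with \<open>y\<close> congruent to
  \<open>x + v\<close>.\<close>

lemma sum_spectrum:
  assumes "Y \<subseteq> box"
  shows "(\<Sum>u\<in>box. spectrum Y u * Re (chi (ip u v))) = real (p ^ card I * card (shift v Y \<inter> Y))"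
proof -
  have fin: "finite Y" using assms finite_subset_box by blast
  have term_eq: "complex_of_real (spectrum Y u) * chi (ip u v) =
      (\<Sum>x\<in>Y. \<Sum>y\<in>Y. chi (ip u (\<lambda>i. x i + v i - y i)))" for u
  proof -
    have "complex_of_real (spectrum Y u) = (\<Sum>x\<in>Y. chi (ip u x)) * cnj (\<Sum>y\<in>Y. chi (ip u y))"
      unfolding spectrum_def by (subst complex_norm_square[symmetric]) simp
    also have "\<dots> = (\<Sum>x\<in>Y. \<Sum>y\<in>Y. chi (ip u x) * chi (- ip u y))"
      by (simp add: sum_product chi_minus)
    finally show ?thesis
      by (simp add: sum_distrib_right chi_add[symmetric] ip_diff ip_add diff_add_eq)
  qed
  have card_eq: "card (shift v Y \<inter> Y) = card {x \<in> Y. red (\<lambda>i. x i + v i) \<in> Y}"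
  proof -
    have "shift v Y \<inter> Y = (\<lambda>x. red (\<lambda>i. x i + v i)) ` {x \<in> Y. red (\<lambda>i. x i + v i) \<in> Y}"
      unfolding shift_def by auto
    moreover have "inj_on (\<lambda>x. red (\<lambda>i. x i + v i)) {x \<in> Y. red (\<lambda>i. x i + v i) \<in> Y}"
      using inj_on_shift by (rule inj_on_subset) (use assms in auto)
    ultimately show ?thesis by (simp add: card_image)
  qed
  have inner: "(\<Sum>y\<in>Y. if \<forall>i\<in>I. int p dvd x i + v i - y i then 1 else 0 :: complex)
      = (if red (\<lambda>i. x i + v i) \<in> Y then 1 else 0)" for x
  proof -
    have "(\<forall>i\<in>I. int p dvd x i + v i - y i) \<longleftrightarrow> y = red (\<lambda>i. x i + v i)" if "y \<in> Y" for y
      using red_eq_iff[of "\<lambda>i. x i + v i" y] red_box[of y] that assms by auto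
    then have "(\<Sum>y\<in>Y. if \<forall>i\<in>I. int p dvd x i + v i - y i then 1 else 0 :: complex)
      = (\<Sum>y\<in>Y. if y = red (\<lambda>i. x i + v i) then 1 else 0)"
      by (intro sum.cong) auto
    then show ?thesis using fin by simp
  qed
  have "(\<Sum>u\<in>box. complex_of_real (spectrum Y u) * chi (ip u v)) =
      (\<Sum>x\<in>Y. \<Sum>y\<in>Y. \<Sum>u\<in>box. chi (ip u (\<lambda>i. x i + v i - y i)))"
    unfolding term_eq
    by (subst sum.swap, rule sum.cong[OF refl], rule sum.swap)
  also have "\<dots> = (\<Sum>x\<in>Y. \<Sum>y\<in>Y. of_nat (p ^ card I) *
      (if \<forall>i\<in>I. int p dvd x i + v i - y i then 1 else 0))"
    unfolding orthogonality by (intro sum.cong refl) auto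
  also have "\<dots> = of_nat (p ^ card I) * (\<Sum>x\<in>Y. if red (\<lambda>i. x i + v i) \<in> Y then 1 else 0)"
    by (simp add: sum_distrib_left[symmetric] inner)
  also have "(\<Sum>x\<in>Y. if red (\<lambda>i. x i + v i) \<in> Y then 1 else 0 :: complex) =
      of_nat (card {x \<in> Y. red (\<lambda>i. x i + v i) \<in> Y})"
    using fin by (simp add: sum.If_cases Int_def)
  finally have "(\<Sum>u\<in>box. complex_of_real (spectrum Y u) * chi (ip u v)) =
      of_nat (p ^ card I * card (shift v Y \<inter> Y))"
    using card_eq by simp
  then have "Re (\<Sum>u\<in>box. complex_of_real (spectrum Y u) * chi (ip u v)) =
      real (p ^ card I * card (shift v Y \<inter> Y))"
    by simp
  then show ?thesis by simp
qed

text \<open>The geometric sum is at most \<open>2 / cmod (1 - chi t)\<close>, the inverse of the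
  sine of \<open>pi * t / p\<close>. As \<open>t\<close> keeps distance \<open>s\<close> from the
  multiples of \<open>p\<close>, this is at most \<open>p / s\<close>, hence at most
  \<open>J / 2\<close>.\<close>

lemma cosine_sum:
  assumes "int s \<le> t" "t \<le> int p - int s" "0 < s" "2 * p \<le> s * J"
  shows "(\<Sum>j<J. Re (chi (int j * t))) \<le> real J / 2"
proof -
  define \<theta> where "\<theta> = pi * of_int t / real p"
  have "real s / real p = (pi * real s / real p) / pi" by simp
  also have "\<dots> \<le> sin \<theta>"
  proof (rule sin_ge_div_pi')
    show "pi * real s / real p \<le> \<theta>"
      unfolding \<theta>_def using assms(1) by (intro divide_right_mono mult_left_mono) auto
    have "real_of_int t \<le> real p - real s" using assms(2) by linarith
    then have "\<theta> \<le> pi * (real p - real s) / real p"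
      unfolding \<theta>_def by (intro divide_right_mono mult_left_mono) auto
    also have "\<dots> = pi - pi * real s / real p"
      using p_pos by (simp add: field_simps)
    finally show "\<theta> \<le> pi - pi * real s / real p" .
  qed simp
  finally have sin_ge: "real s / real p \<le> sin \<theta>" .
  have sin_pos: "0 < sin \<theta>"
    using sin_ge assms p_pos by (smt (verit) divide_pos_pos of_nat_0_less_iff)
  have "chi t = cis (2 * \<theta>)" by (simp add: chi_def \<theta>_def mult.assoc)
  then have "(cmod (1 - chi t))\<^sup>2 = (1 - cos (2 * \<theta>))\<^sup>2 + (sin (2 * \<theta>))\<^sup>2"
    by (simp add: cmod_power2)
  also have "\<dots> = 2 * (1 - cos (2 * \<theta>))"
    using sin_cos_squared_add[of "2 * \<theta>"] by (simp add: power2_eq_square algebra_simps)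
  also have "\<dots> = (2 * sin \<theta>)\<^sup>2"
    by (simp add: cos_double_sin power2_eq_square)
  finally have norm_eq: "cmod (1 - chi t) = 2 * sin \<theta>"
    using sin_pos power2_eq_iff_nonneg[of "cmod (1 - chi t)" "2 * sin \<theta>"] by simp
  then have neq: "chi t \<noteq> 1" using sin_pos by auto
  have "(\<Sum>j<J. Re (chi (int j * t))) = Re (\<Sum>j<J. chi t ^ j)"
    by (simp add: chi_mult)
  also have "\<dots> \<le> cmod (\<Sum>j<J. chi t ^ j)" by (rule complex_Re_le_cmod)
  also have "(\<Sum>j<J. chi t ^ j) = (1 - chi t ^ J) / (1 - chi t)"
    using neq by (simp add: sum_gp_strict)
  also have "cmod \<dots> \<le> 2 / cmod (1 - chi t)"
    unfolding norm_divide
    using norm_triangle_ineq4[of 1 "chi t ^ J"] by (intro divide_right_mono) (auto simp: norm_power norm_chi)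
  also have "\<dots> = 1 / sin \<theta>" using norm_eq by simp
  also have "\<dots> \<le> 1 / (real s / real p)"
    using sin_ge assms p_pos by (intro divide_left_mono mult_pos_pos divide_pos_pos) (auto simp: sin_pos)
  also have "\<dots> \<le> real J / 2"
  proof -
    have "real (2 * p) \<le> real (s * J)" using assms(4) by (simp only: of_nat_le_iff)
    then show ?thesis using assms(3) p_pos by (simp add: field_simps)
  qed
  finally show ?thesis .
qed

text \<open>
  The spectral gap of the translations by multiples \<open>j v\<close>, \<open>j < J\<close>, is bounded below by a constant
  because no affine hyperplane contains many of the \<open>v x\<close>; by subadditivity of \<open>new\<close> passing from
  \<open>j v\<close> back to \<open>v\<close> only loses the factor \<open>J\<close>.
\<close>

lemma growth_large:
  fixes v :: "nat \<Rightarrow> nat \<Rightarrow> int"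
  assumes "Y \<subseteq> box" "2 * card Y \<le> p ^ card I" "finite R" "R \<noteq> {}"
    and "2 * p \<le> s * J" "0 < s"
    and thin: "\<And>u t. \<exists>i\<in>I. \<not> int p dvd u i \<Longrightarrow> card {x \<in> R. int p dvd ip u (v x) - t} \<le> h"
    and "4 * s * h \<le> card R"
  shows "\<exists>x\<in>R. card Y \<le> 8 * J * new (v x) Y"
proof -
  let ?D = "p ^ card I"
  have J: "0 < J" using assms(5) p_pos by (cases J) auto
  have gap: "real (card R) * real J / 4 \<le> (\<Sum>x\<in>R. \<Sum>j<J. 1 - Re (chi (int j * ip u (v x))))"
    if u: "\<exists>i\<in>I. \<not> int p dvd u i" for u
  proof -
    \<comment> \<open>These are the terms whose pairing with \<open>u\<close> lies within distance
      less than \<open>s\<close> of a multiple of \<open>p\<close>. Each of the fewer than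
      \<open>2 * s\<close> residues accounts for at most \<open>h\<close> terms, so at most half of
      \<open>R\<close> is bad.\<close>
    let ?bad = "{x \<in> R. \<exists>t\<in>{- int s<..<int s}. int p dvd ip u (v x) - t}"
    have "?bad = (\<Union>t\<in>{- int s<..<int s}. {x \<in> R. int p dvd ip u (v x) - t})" by auto
    then have "card ?bad \<le> (\<Sum>t\<in>{- int s<..<int s}. card {x \<in> R. int p dvd ip u (v x) - t})"
      by (simp add: card_UN_le)
    also have "\<dots> \<le> (\<Sum>t\<in>{- int s<..<int s}. h)"
      using thin[OF u] by (rule sum_mono)
    also have "\<dots> \<le> 2 * s * h" by (simp add: nat_le_iff)
    finally have "2 * card ?bad \<le> card R" using assms(8) by linarith
    then have good: "real (card R) / 2 \<le> real (card (R - ?bad))"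
      using assms(3) by (subst card_Diff_subset) (auto simp: of_nat_diff card_mono)
    have nonneg: "0 \<le> 1 - Re (chi a)" for a
      using complex_Re_le_cmod[of "chi a"] norm_chi[of a] by simp
    have large: "real J / 2 \<le> (\<Sum>j<J. 1 - Re (chi (int j * ip u (v x))))" if x: "x \<in> R - ?bad" for x
    proof -
      \<comment> \<open>For a good term the least residue \<open>t\<close> of the pairing lies
        between \<open>s\<close> and \<open>p - s\<close>, the range of
        \<open>cosine_sum\<close>.\<close>
      define t where "t = ip u (v x) mod int p"
      have t: "0 \<le> t" "t < int p" unfolding t_def using p_pos by auto
      have dvd: "int p dvd ip u (v x) - t" "int p dvd ip u (v x) - (t - int p)"
        unfolding t_def using dvd_add[of "int p" "ip u (v x) - ip u (v x) mod int p" "int p"]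
        by (auto simp: algebra_simps dvd_minus_mod)
      have "t \<notin> {- int s<..<int s}" "t - int p \<notin> {- int s<..<int s}"
        using x dvd by auto
      then have "int s \<le> t" "t \<le> int p - int s" using t by auto
      then have "(\<Sum>j<J. Re (chi (int j * t))) \<le> real J / 2"
        using assms by (intro cosine_sum) auto
      moreover have "chi (int j * ip u (v x)) = chi (int j * t)" for j
        using dvd(1) by (intro chi_cong) (simp add: right_diff_distrib[symmetric])
      ultimately show ?thesis by (simp add: sum_subtractf)
    qed
    have "real (card R) * real J / 4 \<le> real (card (R - ?bad)) * (real J / 2)"
      using mult_right_mono[OF good, of "real J / 2"] by simp
    also have "\<dots> \<le> (\<Sum>x\<in>R - ?bad. \<Sum>j<J. 1 - Re (chi (int j * ip u (v x))))"
      using sum_bounded_below[of "R - ?bad" "real J / 2", OF large] by simp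
    also have "\<dots> \<le> (\<Sum>x\<in>R. \<Sum>j<J. 1 - Re (chi (int j * ip u (v x))))"
      using assms(3) nonneg by (intro sum_mono2 sum_nonneg) auto
    finally show ?thesis .
  qed
  define z where "z = red (\<lambda>_. 0)"
  have z: "z \<in> box" unfolding z_def by (rule red_in_box)
  have nonzero: "\<exists>i\<in>I. \<not> int p dvd u i" if "u \<in> box - {z}" for u
    using that box_eqI[of u z] z by (auto simp: z_def red_apply)
  have ipz: "chi (ip z w) = 1" for w
    using ip_red[of w "\<lambda>_. 0"] by (simp add: chi_eq_1_iff z_def ip_commute ip_def)
  have spectrum_z: "spectrum Y z = real (card Y) ^ 2"
    by (simp add: spectrum_def ipz norm_of_nat)
  have total: "(\<Sum>u\<in>box. spectrum Y u) = real ?D * real (card Y)"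
  proof -
    have "shift (\<lambda>_. 0) Y \<inter> Y = Y"
      unfolding shift_def using assms(1) red_box by (auto simp: subset_iff image_iff)
    then show ?thesis
      using sum_spectrum[OF assms(1), of "\<lambda>_. 0"] by (simp add: ip_def chi_zero)
  qed
  \<comment> \<open>Subtracting the autocorrelation at \<open>w\<close> from its value at zero turns
    the gain into a nonnegative combination of the quantities that \<open>gap\<close> bounds below
    on average.\<close>
  have new_eq: "real ?D * real (new w Y) = (\<Sum>u\<in>box. spectrum Y u * (1 - Re (chi (ip u w))))" for w
  proof -
    have "real (new w Y) = real (card Y) - real (card (shift w Y \<inter> Y))"
      using card_shift_Int[OF assms(1), of w] by linarith
    then have "real ?D * real (new w Y) = real ?D * real (card Y) - real (?D * card (shift w Y \<inter> Y))"
      by (simp add: right_diff_distrib)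
    then show ?thesis
      unfolding total[symmetric] sum_spectrum[OF assms(1), symmetric]
      by (simp add: right_diff_distrib sum_subtractf)
  qed
  \<comment> \<open>The zero frequency \<open>z\<close> carries only \<open>card Y ^ 2\<close>, at
    most half of the total mass since \<open>Y\<close> fills at most half of the box. The remaining
    mass sits on frequencies with a gap.\<close>
  have "real ?D * (real (card Y) / 2) \<le> (\<Sum>u\<in>box - {z}. spectrum Y u)"
  proof -
    have "(\<Sum>u\<in>box - {z}. spectrum Y u) = real ?D * real (card Y) - real (card Y) ^ 2"
      using sum_diff1[OF finite_box, of "spectrum Y" z] z total spectrum_z by simp
    moreover have "real (card Y) * (2 * real (card Y)) \<le> real (card Y) * real ?D"
      using assms(2) by (intro mult_left_mono) (auto simp flip: of_nat_power of_nat_mult simp: of_nat_le_iff)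
    ultimately show ?thesis by (simp add: power2_eq_square algebra_simps)
  qed
  then have "real ?D * (real (card Y) / 2) * (real (card R) * real J / 4) \<le>
      (\<Sum>u\<in>box - {z}. spectrum Y u) * (real (card R) * real J / 4)"
    by (rule mult_right_mono) simp
  also have "\<dots> \<le> (\<Sum>u\<in>box - {z}. spectrum Y u * (\<Sum>x\<in>R. \<Sum>j<J. 1 - Re (chi (int j * ip u (v x)))))"
    unfolding sum_distrib_right
    using gap nonzero spectrum_nonneg by (intro sum_mono mult_left_mono) blast+
  also have "\<dots> = (\<Sum>u\<in>box. spectrum Y u * (\<Sum>x\<in>R. \<Sum>j<J. 1 - Re (chi (int j * ip u (v x)))))"
  proof (rule sum.mono_neutral_left)
    have "chi (int j * ip z w) = 1" for j w by (simp add: chi_mult ipz)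
    then show "\<forall>u\<in>box - (box - {z}). spectrum Y u * (\<Sum>x\<in>R. \<Sum>j<J. 1 - Re (chi (int j * ip u (v x)))) = 0"
      by auto
  qed (use finite_box in auto)
  also have "\<dots> = (\<Sum>u\<in>box. \<Sum>x\<in>R. \<Sum>j<J. spectrum Y u * (1 - Re (chi (ip u (\<lambda>i. int j * v x i)))))"
    by (simp add: sum_distrib_left ip_mult)
  also have "\<dots> = (\<Sum>x\<in>R. \<Sum>j<J. \<Sum>u\<in>box. spectrum Y u * (1 - Re (chi (ip u (\<lambda>i. int j * v x i)))))"
    by (subst sum.swap, rule sum.cong[OF refl], rule sum.swap)
  also have "\<dots> = (\<Sum>x\<in>R. \<Sum>j<J. real ?D * real (new (\<lambda>i. int j * v x i) Y))"
    by (simp only: new_eq)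
  also have "\<dots> \<le> (\<Sum>x\<in>R. \<Sum>j<J. real ?D * real (J * new (v x) Y))"
  proof (intro sum_mono mult_left_mono)
    fix x j assume "j \<in> {..<J}"
    then have "new (\<lambda>i. int j * v x i) Y \<le> J * new (v x) Y"
      using new_mult[OF assms(1), of j "v x"] by (meson le_trans less_imp_le mult_le_mono1 lessThan_iff)
    then show "real (new (\<lambda>i. int j * v x i) Y) \<le> real (J * new (v x) Y)" by (simp only: of_nat_le_iff)
  qed auto
  also have "\<dots> = real ?D * (real J * (\<Sum>x\<in>R. real (J * new (v x) Y)))"
    by (simp add: sum_distrib_left algebra_simps)
  finally have "real J * (real (card R) * real (card Y)) \<le> real J * (\<Sum>x\<in>R. real (8 * J * new (v x) Y))"
  proof -
    assume *: "real ?D * (real (card Y) / 2) * (real (card R) * real J / 4)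
      \<le> real ?D * (real J * (\<Sum>x\<in>R. real (J * new (v x) Y)))"
    have "(\<Sum>x\<in>R. real (8 * J * new (v x) Y)) = 8 * (\<Sum>x\<in>R. real (J * new (v x) Y))"
      by (simp add: sum_distrib_left mult.assoc)
    moreover have "real ?D * (real J * (real (card R) * real (card Y)))
      \<le> real ?D * (real J * (8 * (\<Sum>x\<in>R. real (J * new (v x) Y))))"
      using * by (simp add: ac_simps)
    moreover have "0 < real ?D" using p_pos by simp
    ultimately show ?thesis by (simp only: mult_le_cancel_left_pos)
  qed
  then have le: "real (card R) * real (card Y) \<le> (\<Sum>x\<in>R. real (8 * J * new (v x) Y))"
    using J by simp
  show ?thesis
  proof (rule ccontr)
    assume "\<not> ?thesis"
    then have "(\<Sum>x\<in>R. real (8 * J * new (v x) Y)) < (\<Sum>x\<in>R. real (card Y))"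
      using assms by (intro sum_strict_mono) (auto simp: not_le simp del: of_nat_mult)
    with le show False by simp
  qed
qed

end

section \<open>Zero-sum subsequences modulo a prime\<close>

context prime_vectors
begin

text \<open>All sums use the same number of terms, so that a zero-sum set of exactly
  \<open>p\<close> terms can be assembled later.\<close>

definition realized :: "(nat \<Rightarrow> nat \<Rightarrow> int) \<Rightarrow> nat set \<Rightarrow> nat \<Rightarrow> (nat \<Rightarrow> int) set \<Rightarrow> bool"
  where "realized a U n Y \<longleftrightarrow> (\<forall>y\<in>Y. \<exists>T\<subseteq>U. card T = n \<and> red (\<lambda>i. \<Sum>t\<in>T. a t i) = y)"

text \<open>Two indices are budgeted per summand, because a growth step spends a pair. The number
  \<open>n\<close> is only an upper bound, so a stage may stop early.\<close>

definition reach :: "(nat \<Rightarrow> nat \<Rightarrow> int) \<Rightarrow> nat set \<Rightarrow> nat \<Rightarrow> (nat \<Rightarrow> int) set \<Rightarrow> bool"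
  where "reach a R n Y \<longleftrightarrow> Y \<subseteq> box \<and> Y \<noteq> {} \<and>
    (\<exists>U n'. U \<subseteq> R \<and> n' \<le> n \<and> card U \<le> 2 * n' \<and> realized a U n' Y)"

text \<open>Allowing every offset \<open>t\<close> covers all affine hyperplanes; hence the
  condition survives subtracting a fixed vector from all terms, as in
  \<open>thin_diff\<close>.\<close>

definition thin :: "(nat \<Rightarrow> nat \<Rightarrow> int) \<Rightarrow> nat set \<Rightarrow> nat \<Rightarrow> bool"
  where "thin a R h \<longleftrightarrow>
    (\<forall>u t. (\<exists>i\<in>I. \<not> int p dvd u i) \<longrightarrow> card {x \<in> R. int p dvd ip u (a x) - t} \<le> h)"

lemma thin_subset:
  assumes "thin a R h" "R' \<subseteq> R" "finite R"
  shows "thin a R' h"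
  unfolding thin_def
proof (intro allI impI)
  fix u t assume "\<exists>i\<in>I. \<not> int p dvd u i"
  then have "card {x \<in> R. int p dvd ip u (a x) - t} \<le> h"
    using assms(1) unfolding thin_def by blast
  moreover have "card {x \<in> R'. int p dvd ip u (a x) - t} \<le> card {x \<in> R. int p dvd ip u (a x) - t}"
    using assms by (intro card_mono) auto
  ultimately show "card {x \<in> R'. int p dvd ip u (a x) - t} \<le> h" by linarith
qed

lemma reach_mono: "reach a R n Y \<Longrightarrow> n \<le> m \<Longrightarrow> reach a R m Y"
  unfolding reach_def using le_trans by blast

lemma realized_extend:
  assumes "realized a U n Y" "finite U" "x \<notin> U"
  shows "realized a (insert x U) (Suc n) (shift (a x) Y)"
  unfolding realized_def
proof
  fix z assume "z \<in> shift (a x) Y"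
  then obtain y where y: "y \<in> Y" "z = red (\<lambda>i. y i + a x i)" unfolding shift_def by blast
  then obtain T where T: "T \<subseteq> U" "card T = n" "red (\<lambda>i. \<Sum>t\<in>T. a t i) = y"
    using assms unfolding realized_def by blast
  have fin: "finite T" "x \<notin> T" using T assms finite_subset by auto
  have "red (\<lambda>i. \<Sum>t\<in>insert x T. a t i) = z"
    using fin y(2) unfolding T(3)[symmetric] red_red_add by (simp add: add.commute)
  then show "\<exists>T'\<subseteq>insert x U. card T' = Suc n \<and> red (\<lambda>i. \<Sum>t\<in>T'. a t i) = z"
    using T fin by (intro exI[of _ "insert x T"]) auto
qed

lemma realized_mono: "realized a U n Y \<Longrightarrow> U \<subseteq> V \<Longrightarrow> realized a V n Y"
  unfolding realized_def by (meson order_trans)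

lemma realized_Un: "realized a U n Y \<Longrightarrow> realized a U n Z \<Longrightarrow> realized a U n (Y \<union> Z)"
  unfolding realized_def by blast

text \<open>Moving both translates back by \<open>w\<close> leaves \<open>Y\<close> and its
  translate by \<open>v - w\<close>. Growth is therefore governed by the difference of the two spent
  terms.\<close>

lemma card_shift_Un:
  assumes "Y \<subseteq> box"
  shows "card (shift w Y \<union> shift v Y) = card Y + new (\<lambda>i. v i - w i) Y"
proof -
  let ?v = "\<lambda>i. v i - w i"
  have "shift v Y = shift w (shift ?v Y)" by (simp add: shift_shift)
  then have "shift w Y \<union> shift v Y = shift w (Y \<union> shift ?v Y)" by (simp add: shift_Un)
  then have "card (shift w Y \<union> shift v Y) = card (Y \<union> shift ?v Y)"
    using assms shift_subset_box by (simp add: card_shift)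
  also have "\<dots> = card Y + card (shift ?v Y - Y)"
    using assms shift_subset_box finite_subset_box
    by (subst Un_Diff_cancel[symmetric], intro card_Un_disjoint) auto
  finally show ?thesis unfolding new_def .
qed

text \<open>
  Each step spends two fresh terms \<open>x0\<close>, \<open>x\<close>, of which a realized sum uses exactly one, so that
  all sums of a stage have the same number of terms.
\<close>

lemma iterate:
  assumes "finite R" "0 < c" "0 < k"
    and growth: "\<And>R' Y x0. R' \<subseteq> R \<Longrightarrow> c \<le> card R' \<Longrightarrow> Y \<subseteq> box \<Longrightarrow> 2 * card Y \<le> B \<Longrightarrow> x0 \<in> R' \<Longrightarrow>
      \<exists>x\<in>R'. card Y \<le> k * new (\<lambda>i. a x i - a x0 i) Y"
    and start: "reach a R n Y"
    and "c + 2 * (n + t) \<le> card R"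
  shows "\<exists>Y'. reach a R (n + t) Y' \<and>
    (B < 2 * card Y' \<or> (1 + 1 / real k) ^ t * real (card Y) \<le> real (card Y'))"
  using \<open>c + 2 * (n + t) \<le> card R\<close>
proof (induction t)
  case 0
  then show ?case using start by auto
next
  case (Suc t)
  then obtain Z where Z: "reach a R (n + t) Z"
    and alt: "B < 2 * card Z \<or> (1 + 1 / real k) ^ t * real (card Y) \<le> real (card Z)"
    by auto
  show ?case
  proof (cases "B < 2 * card Z")
    case True
    then show ?thesis using reach_mono[OF Z, of "n + Suc t"] by auto
  next
    case False
    obtain U n' where U: "U \<subseteq> R" "n' \<le> n + t" "card U \<le> 2 * n'" "realized a U n' Z"
      and ZB: "Z \<subseteq> box" "Z \<noteq> {}"
      using Z unfolding reach_def by blast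
    have finU: "finite U" using U \<open>finite R\<close> finite_subset by blast
    have "card (R - U) = card R - card U" using U finU by (simp add: card_Diff_subset)
    moreover have "card U + c \<le> card R" using U(2,3) Suc.prems by simp
    ultimately have c: "c \<le> card (R - U)" by simp
    then have "R - U \<noteq> {}" using \<open>0 < c\<close> by (metis card.empty not_less)
    then obtain x0 where x0: "x0 \<in> R - U" by blast
    obtain x where x: "x \<in> R - U" "card Z \<le> k * new (\<lambda>i. a x i - a x0 i) Z"
      using growth[OF _ c ZB(1) _ x0] False by auto
    have Z0: "0 < card Z" using ZB finite_subset_box by (simp add: card_gt_0_iff)
    have "x \<noteq> x0"
    proof
      assume "x = x0"
      then have "new (\<lambda>i. a x i - a x0 i) Z = 0" using new_zero[OF ZB(1)] by simp
      with x Z0 show False by simp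
    qed
    let ?Z = "shift (a x0) Z \<union> shift (a x) Z"
    let ?U = "insert x0 (insert x U)"
    have "realized a ?U (Suc n') ?Z"
      using realized_extend[OF U(4) finU, of x0] realized_extend[OF U(4) finU, of x] x x0
      by (intro realized_Un) (auto elim: realized_mono)
    moreover have "?U \<subseteq> R" using U x x0 by auto
    moreover have "card ?U \<le> 2 * Suc n'" using U finU by (simp add: card_insert_if)
    moreover have "?Z \<subseteq> box" "?Z \<noteq> {}" using shift_subset_box ZB by (auto simp: shift_def)
    ultimately have "reach a R (n + Suc t) ?Z"
      unfolding reach_def using U(2)
      by (intro conjI exI[of _ ?U] exI[of _ "Suc n'"]) auto
    moreover have "(1 + 1 / real k) ^ Suc t * real (card Y) \<le> real (card ?Z)"
    proof -
      have "(1 + 1 / real k) ^ Suc t * real (card Y) \<le> (1 + 1 / real k) * real (card Z)"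
        using alt False by (simp add: mult.assoc mult_left_mono)
      also have "\<dots> = real (card Z) + real (card Z) / real k" by (simp add: algebra_simps)
      also have "\<dots> \<le> real (card Z) + real (new (\<lambda>i. a x i - a x0 i) Z)"
      proof -
        have "real (card Z) \<le> real (k * new (\<lambda>i. a x i - a x0 i) Z)"
          using x(2) by (simp only: of_nat_le_iff)
        then show ?thesis using \<open>0 < k\<close> by (simp add: field_simps)
      qed
      also have "\<dots> = real (card ?Z)" using card_shift_Un[OF ZB(1)] by simp
      finally show ?thesis .
    qed
    ultimately show ?thesis by blast
  qed
qed

text \<open>By Bernoulli's inequality, \<open>k\<close> steps with growth factor
  \<open>1 + 1 / k\<close> at least double the set.\<close>

lemma iterate_doubling:
  assumes "finite R" "0 < c" "0 < k"
    and "\<And>R' Y x0. R' \<subseteq> R \<Longrightarrow> c \<le> card R' \<Longrightarrow> Y \<subseteq> box \<Longrightarrow> 2 * card Y \<le> B \<Longrightarrow> x0 \<in> R' \<Longrightarrow>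
      \<exists>x\<in>R'. card Y \<le> k * new (\<lambda>i. a x i - a x0 i) Y"
    and "reach a R n Y"
    and "c + 2 * (n + k * q) \<le> card R"
  shows "\<exists>Y'. reach a R (n + k * q) Y' \<and> (B < 2 * card Y' \<or> 2 ^ q * card Y \<le> card Y')"
proof -
  obtain Y' where Y': "reach a R (n + k * q) Y'"
    "B < 2 * card Y' \<or> (1 + 1 / real k) ^ (k * q) * real (card Y) \<le> real (card Y')"
    using iterate[OF assms] by blast
  have "2 \<le> (1 + 1 / real k) ^ k"
    using Bernoulli_inequality[OF order_trans[OF _ divide_nonneg_nonneg], of 1 "real k" k] \<open>0 < k\<close> by simp
  then have "2 ^ q \<le> (1 + 1 / real k) ^ (k * q)"
    unfolding power_mult by (intro power_mono) auto
  then have "2 ^ q * real (card Y) \<le> (1 + 1 / real k) ^ (k * q) * real (card Y)"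
    by (rule mult_right_mono) simp
  then have "B < 2 * card Y' \<or> real (2 ^ q * card Y) \<le> real (card Y')"
    using Y'(2) by auto
  then show ?thesis using Y'(1) by (auto simp only: of_nat_le_iff)
qed

lemma thin_diff:
  assumes "thin a R h" "\<exists>i\<in>I. \<not> int p dvd u i"
  shows "card {x \<in> R. int p dvd ip u (\<lambda>i. a x i - a x0 i) - t} \<le> h"
proof -
  have "{x \<in> R. int p dvd ip u (\<lambda>i. a x i - a x0 i) - t} =
      {x \<in> R. int p dvd ip u (a x) - (ip u (a x0) + t)}"
    by (simp add: ip_diff algebra_simps)
  then show ?thesis using assms unfolding thin_def by simp
qed

text \<open>Induction over the scales \<open>L = 2 ^ s\<close>. At the next scale
  \<open>growth_small\<close> works up to half of \<open>L ^ card I\<close>, and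
  \<open>card I\<close> doublings make up for the increase of that target by the factor
  \<open>2 ^ card I\<close>.\<close>

lemma reach_small:
  assumes "finite R" "thin a R h" "I \<noteq> {}" "2 ^ s \<le> p"
    and "h + 1 + 8 * card I ^ 2 * 2 ^ s \<le> card R"
  shows "\<exists>Y. reach a R (4 * card I ^ 2 * 2 ^ s) Y \<and> 2 ^ (s * card I) \<le> 2 * card Y"
  using assms(4,5)
proof (induction s)
  case 0
  have "reach a R 0 {red (\<lambda>_. 0)}"
    unfolding reach_def realized_def using red_in_box by (auto intro!: exI[of _ "{}"])
  then have "reach a R (4 * card I ^ 2 * 2 ^ 0) {red (\<lambda>_. 0)}"
    by (rule reach_mono) simp
  then show ?case by (intro exI[of _ "{red (\<lambda>_. 0)}"]) simp
next
  case (Suc s)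
  let ?d = "card I"
  have d: "0 < ?d" using assms finite_I by (simp add: card_gt_0_iff)
  obtain Y where Y: "reach a R (4 * ?d ^ 2 * 2 ^ s) Y" "2 ^ (s * ?d) \<le> 2 * card Y"
    using Suc by auto
  have "\<exists>x\<in>R'. card Y \<le> (2 * ?d * 2 ^ Suc s) * new (\<lambda>i. a x i - a x0 i) Y"
    if "R' \<subseteq> R" "h + 1 \<le> card R'" "Y \<subseteq> box" "2 * card Y \<le> (2 ^ Suc s) ^ ?d" "x0 \<in> R'" for R' Y x0
  proof (rule growth_small)
    fix u assume u: "\<exists>i\<in>I. \<not> int p dvd u i"
    show "\<exists>x\<in>R'. \<not> int p dvd ip u (\<lambda>i. a x i - a x0 i)"
    \<comment> \<open>If \<open>u\<close> were orthogonal to all differences, \<open>R'\<close>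
      would lie in one affine hyperplane, although it has more than \<open>h\<close>
      elements.\<close>
    proof (rule ccontr)
      assume "\<not> ?thesis"
      then have "{x \<in> R'. int p dvd ip u (\<lambda>i. a x i - a x0 i) - 0} = R'" by auto
      then have "card R' \<le> h"
        using thin_diff[OF thin_subset[OF assms(2) that(1) assms(1)] u, of x0 0] by simp
      with that show False by simp
    qed
  qed (use that Suc.prems assms(1) finite_subset in auto)
  note growth = this
  \<comment> \<open>The \<open>card I\<close> doublings at this scale cost as many steps as the
    whole budget so far, so the budget doubles with the scale.\<close>
  have steps: "4 * ?d ^ 2 * 2 ^ s + (2 * ?d * 2 ^ Suc s) * ?d = 4 * ?d ^ 2 * 2 ^ Suc s"
    by (simp add: power2_eq_square)
  have "\<exists>Y'. reach a R (4 * ?d ^ 2 * 2 ^ s + (2 * ?d * 2 ^ Suc s) * ?d) Y' \<and>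
    ((2 ^ Suc s) ^ ?d < 2 * card Y' \<or> 2 ^ ?d * card Y \<le> card Y')"
  proof (rule iterate_doubling[OF assms(1) _ _ growth Y(1)])
    show "h + 1 + 2 * (4 * ?d ^ 2 * 2 ^ s + (2 * ?d * 2 ^ Suc s) * ?d) \<le> card R"
      unfolding steps using Suc.prems by simp
  qed (use d in auto)
  then obtain Y' where Y': "reach a R (4 * ?d ^ 2 * 2 ^ Suc s) Y'"
    "(2 ^ Suc s) ^ ?d < 2 * card Y' \<or> 2 ^ ?d * card Y \<le> card Y'"
    unfolding steps by blast
  have "2 ^ (Suc s * ?d) \<le> 2 * card Y'"
  proof (cases "2 ^ ?d * card Y \<le> card Y'")
    case True
    have "2 ^ (Suc s * ?d) = 2 ^ ?d * (2 ^ (s * ?d) :: nat)" by (simp add: power_add)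
    also have "\<dots> \<le> 2 ^ ?d * (2 * card Y)" using Y(2) by (rule mult_left_mono) simp
    also have "\<dots> \<le> 2 * card Y'" using True by simp
    finally show ?thesis .
  next
    case False
    then have "(2 ^ Suc s) ^ ?d < 2 * card Y'" using Y'(2) by blast
    then show ?thesis unfolding power_mult by (rule less_imp_le)
  qed
  then show ?case using Y'(1) by blast
qed

text \<open>Either the growth stops because half of the box is exceeded, or \<open>q\<close>
  doublings take place and exceed it by the assumption on \<open>Y\<close>.\<close>

lemma reach_large:
  assumes "finite R" "thin a R h" "2 * p \<le> s * J" "0 < s"
    and "reach a R n Y" "p ^ card I < 2 * (2 ^ q * card Y)"
    and "4 * s * h + 1 + 2 * (n + 8 * J * q) \<le> card R"
  shows "\<exists>Y'. reach a R (n + 8 * J * q) Y' \<and> p ^ card I < 2 * card Y'"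
proof -
  have J: "0 < J" using assms p_pos by (cases J) auto
  have "\<exists>x\<in>R'. card Z \<le> 8 * J * new (\<lambda>i. a x i - a x0 i) Z"
    if "R' \<subseteq> R" "4 * s * h + 1 \<le> card R'" "Z \<subseteq> box" "2 * card Z \<le> p ^ card I" "x0 \<in> R'" for R' Z x0
  proof (rule growth_large)
    show "card {x \<in> R'. int p dvd ip u (\<lambda>i. a x i - a x0 i) - t} \<le> h"
      if "\<exists>i\<in>I. \<not> int p dvd u i" for u t
      using thin_diff[OF thin_subset[OF assms(2) \<open>R' \<subseteq> R\<close> assms(1)] that] .
  qed (use that assms finite_subset in auto)
  then obtain Y' where "reach a R (n + 8 * J * q) Y'"
    "p ^ card I < 2 * card Y' \<or> 2 ^ q * card Y \<le> card Y'"
    using iterate_doubling[OF assms(1), of "4 * s * h + 1" "8 * J" "p ^ card I" a n Y q] assms J by auto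
  then show ?thesis using assms(6) by auto
qed

lemma reach_half:
  assumes "finite R" "thin a R h" "I \<noteq> {}"
    and q: "q = 64 * card I ^ 3 + 1" "64 * q \<le> p"
    and "1024 * q * h + p + 1 \<le> card R"
  shows "\<exists>Y. reach a R (p div 4) Y \<and> p ^ card I < 2 * card Y"
proof -
  let ?d = "card I"
  have d: "0 < ?d" using assms finite_I by (simp add: card_gt_0_iff)
  have dq: "32 * ?d ^ 2 \<le> p"
  proof -
    have "?d ^ 2 \<le> ?d ^ 3" using d by (intro power_increasing) auto
    then show ?thesis using q by linarith
  qed
  \<comment> \<open>This makes \<open>2 ^ s\<close> proportional to \<open>p\<close>: by
    \<open>s2\<close> the first stage costs at most \<open>p / 8\<close>, and by \<open>s1\<close>
    it ends with a set whose density is bounded below in terms of \<open>card I\<close>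
    alone.\<close>
  define s where "s = (LEAST s. p < 64 * ?d ^ 2 * 2 ^ s)"
  have "p < 64 * ?d ^ 2 * 2 ^ p"
  proof -
    have "p < 2 ^ p" by (rule less_exp)
    also have "(2::nat) ^ p \<le> 64 * ?d ^ 2 * 2 ^ p" using d by simp
    finally show ?thesis .
  qed
  then have s1: "p < 64 * ?d ^ 2 * 2 ^ s" unfolding s_def by (rule LeastI)
  have s2: "32 * ?d ^ 2 * 2 ^ s \<le> p"
  proof (cases s)
    case 0
    then show ?thesis using dq by simp
  next
    case (Suc s')
    then have "s' < (LEAST s. p < 64 * ?d ^ 2 * 2 ^ s)" unfolding s_def by simp
    then have "\<not> p < 64 * ?d ^ 2 * 2 ^ s'" by (rule not_less_Least)
    then show ?thesis using Suc by simp
  qed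
  \<comment> \<open>By \<open>J1\<close> the second stage costs at most \<open>p / 8\<close>; by
    \<open>J2\<close> the width \<open>256 * q\<close>, independent of \<open>p\<close>, is enough
    for the spectral gap.\<close>
  define J where "J = p div (64 * q)"
  have J1: "64 * q * J \<le> p" unfolding J_def by simp
  have q0: "0 < 64 * q" unfolding q(1) by simp
  have "64 * q * 1 div (64 * q) \<le> J" unfolding J_def using q(2) by (intro div_le_mono) simp
  then have "64 * q * 1 \<le> 64 * q * J" using q0 by (intro mult_le_mono2) simp
  moreover have "p < 64 * q + 64 * q * J"
    unfolding J_def using dividend_less_times_div[OF q0, of p] by simp
  ultimately have "p \<le> 2 * (64 * q * J)" unfolding mult_1_right by linarith
  then have J2: "2 * p \<le> 256 * q * J" by (simp add: mult.commute)
  have "\<exists>Y. reach a R (4 * ?d ^ 2 * 2 ^ s) Y \<and> 2 ^ (s * ?d) \<le> 2 * card Y"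
  proof (rule reach_small[OF assms(1-3)])
    have "1 \<le> 32 * ?d ^ 2" using d by (simp add: Suc_le_eq)
    from order_trans[OF mult_le_mono1[OF this] s2] show "2 ^ s \<le> p" by simp
    have "h \<le> 1024 * q * h" using q by simp
    then show "h + 1 + 8 * ?d ^ 2 * 2 ^ s \<le> card R" using s2 assms(6) by linarith
  qed
  then obtain Y where Y: "reach a R (4 * ?d ^ 2 * 2 ^ s) Y" "2 ^ (s * ?d) \<le> 2 * card Y" by blast
  \<comment> \<open>The constant \<open>q\<close> is chosen for this estimate: the density lost at
    the first stage is made up by \<open>q\<close> doublings, as \<open>64 * ?d ^ 2\<close> is below
    \<open>2 ^ (64 * ?d ^ 2)\<close>.\<close>
  have "p ^ ?d \<le> (64 * ?d ^ 2 * 2 ^ s) ^ ?d" using s1 by (intro power_mono) auto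
  also have "\<dots> = (64 * ?d ^ 2) ^ ?d * 2 ^ (s * ?d)"
    by (simp add: power_mult power_mult_distrib)
  also have "\<dots> \<le> (2 ^ (64 * ?d ^ 2)) ^ ?d * (2 * card Y)"
    using Y(2) less_imp_le[OF less_exp] by (intro mult_mono power_mono) auto
  also have "\<dots> = 2 ^ (64 * ?d ^ 3 + 1) * card Y"
    by (simp add: power_mult[symmetric] power3_eq_cube power2_eq_square algebra_simps)
  also have "\<dots> < 2 * (2 ^ q * card Y)"
  proof -
    have "0 < card Y" using Y(1) finite_subset_box unfolding reach_def by (auto simp: card_gt_0_iff)
    then show ?thesis using q by simp
  qed
  finally have big: "p ^ ?d < 2 * (2 ^ q * card Y)" .
  have steps4: "4 * (4 * ?d ^ 2 * 2 ^ s + 8 * J * q) \<le> p"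
    using s2 J1 by (simp add: algebra_simps)
  then have steps: "4 * ?d ^ 2 * 2 ^ s + 8 * J * q \<le> p div 4"
    by (simp add: less_eq_div_iff_mult_less_eq algebra_simps)
  have "\<exists>Y'. reach a R (4 * ?d ^ 2 * 2 ^ s + 8 * J * q) Y' \<and> p ^ ?d < 2 * card Y'"
  proof (rule reach_large[OF assms(1,2) J2 _ Y(1) big])
    show "0 < 256 * q" using q by simp
    show "4 * (256 * q) * h + 1 + 2 * (4 * ?d ^ 2 * 2 ^ s + 8 * J * q) \<le> card R"
      using steps4 assms(6) by (simp add: algebra_simps)
  qed
  then show ?thesis using reach_mono steps by blast
qed

section \<open>Zero-sum subsequences of length exactly \<open>p\<close>\<close>

text \<open>Two sets that each fill more than half of the box come from disjoint sets of terms.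
  Reflecting one of them about a prescribed total makes it meet the other.\<close>

lemma thin_zero_sum:
  assumes "finite R" "thin a R h" "I \<noteq> {}"
    and q: "q = 64 * card I ^ 3 + 1" "64 * q \<le> p"
    and "1024 * q * h + 3 * p + 1 \<le> card R"
  shows "\<exists>T\<subseteq>R. card T = p \<and> (\<forall>i\<in>I. int p dvd (\<Sum>t\<in>T. a t i))"
proof -
  let ?d = "card I"
  obtain Y1 where "reach a R (p div 4) Y1" and Y1: "p ^ ?d < 2 * card Y1"
    using reach_half[OF assms(1-3) q] assms(6) by auto
  then obtain U1 n1 where U1: "U1 \<subseteq> R" "n1 \<le> p div 4" "card U1 \<le> 2 * n1" "realized a U1 n1 Y1"
    and Y1b: "Y1 \<subseteq> box"
    unfolding reach_def by blast
  have fin1: "finite U1" using U1 assms(1) finite_subset by blast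
  have "card (R - U1) = card R - card U1" using U1 fin1 by (simp add: card_Diff_subset)
  moreover have "card U1 + (1024 * q * h + 2 * p + 1) \<le> card R"
    using U1(2,3) assms(6) div_times_less_eq_dividend[of p 4] by linarith
  ultimately have c1: "1024 * q * h + 2 * p + 1 \<le> card (R - U1)" by simp
  have "thin a (R - U1) h" using thin_subset[OF assms(2) _ assms(1)] by auto
  then obtain Y2 where "reach a (R - U1) (p div 4) Y2" and Y2: "p ^ ?d < 2 * card Y2"
    using reach_half[OF finite_Diff[OF assms(1)] _ assms(3) q] c1 by fastforce
  then obtain U2 n2 where U2: "U2 \<subseteq> R - U1" "n2 \<le> p div 4" "card U2 \<le> 2 * n2" "realized a U2 n2 Y2"
    and Y2b: "Y2 \<subseteq> box"
    unfolding reach_def by blast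
  have fin2: "finite U2" using U2 assms(1) finite_subset by blast
  have "card (R - U1 - U2) = card (R - U1) - card U2" using U2 fin2 by (simp add: card_Diff_subset)
  moreover have "card U2 + p \<le> card (R - U1)"
    using U2(2,3) c1 div_times_less_eq_dividend[of p 4] by linarith
  \<comment> \<open>Since \<open>n1\<close> and \<open>n2\<close> are at most
    \<open>p div 4\<close>, a filler \<open>Z\<close> of unspent terms can bring the length to
    exactly \<open>p\<close>; its sum enters the reflection \<open>?f\<close>.\<close>
  ultimately have "p - n1 - n2 \<le> card (R - U1 - U2)" by simp
  then obtain Z where Z: "Z \<subseteq> R - U1 - U2" "card Z = p - n1 - n2" "finite Z"
    by (rule obtain_subset_with_card_n)
  define \<sigma> where "\<sigma> = (\<lambda>i. \<Sum>t\<in>Z. a t i)"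
  let ?f = "\<lambda>y. red (\<lambda>i. - \<sigma> i - y i)"
  have "inj_on ?f Y2"
    using Y2b by (intro inj_onI box_eqI) (auto simp: red_eq_iff dvd_diff_commute)
  then have "card (?f ` Y2) = card Y2" by (rule card_image)
  moreover have "card (?f ` Y2 \<union> Y1) \<le> card box"
    using Y1b red_in_box by (intro card_mono finite_box) auto
  ultimately have "?f ` Y2 \<inter> Y1 \<noteq> {}"
    using Y1 Y2 Y1b Y2b finite_subset_box card_Un_disjoint[of "?f ` Y2" Y1] by (force simp: card_box)
  then obtain y1 y2 where y: "y1 \<in> Y1" "y2 \<in> Y2" "y1 = ?f y2" by blast
  obtain T1 where T1: "T1 \<subseteq> U1" "card T1 = n1" "red (\<lambda>i. \<Sum>t\<in>T1. a t i) = y1"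
    using U1(4) y(1) unfolding realized_def by blast
  obtain T2 where T2: "T2 \<subseteq> U2" "card T2 = n2" "red (\<lambda>i. \<Sum>t\<in>T2. a t i) = y2"
    using U2(4) y(2) unfolding realized_def by blast
  have finT: "finite T1" "finite T2" using T1 T2 fin1 fin2 finite_subset by blast+
  have disj: "T1 \<inter> T2 = {}" "(T1 \<union> T2) \<inter> Z = {}" using T1 T2 U1 U2 Z by auto
  have "card (T1 \<union> T2 \<union> Z) = p"
    using finT Z disj T1 T2 U1(2) U2(2) by (simp add: card_Un_disjoint)
  moreover have "int p dvd (\<Sum>t\<in>T1 \<union> T2 \<union> Z. a t i)" if "i \<in> I" for i
  proof -
    have "red (\<lambda>i. \<Sum>t\<in>T1. a t i) = red (\<lambda>i. - \<sigma> i - y2 i)"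
      using T1(3) y(3) by simp
    then have "int p dvd (\<Sum>t\<in>T1. a t i) - (- \<sigma> i - y2 i)"
      using that unfolding red_eq_iff by (rule bspec)
    moreover have "red (\<lambda>i. \<Sum>t\<in>T2. a t i) = red y2"
      using T2(3) Y2b y(2) red_box by auto
    then have "int p dvd (\<Sum>t\<in>T2. a t i) - y2 i"
      using that unfolding red_eq_iff by (rule bspec)
    ultimately have "int p dvd (\<Sum>t\<in>T1. a t i) - (- \<sigma> i - y2 i) + ((\<Sum>t\<in>T2. a t i) - y2 i)"
      by (rule dvd_add)
    then show ?thesis
      using finT Z disj by (simp add: sum.union_disjoint \<sigma>_def algebra_simps)
  qed
  moreover have "T1 \<union> T2 \<union> Z \<subseteq> R" using T1 T2 U1 U2 Z by auto
  ultimately show ?thesis by blast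
qed

text \<open>Among so many terms some \<open>p\<close> are congruent, and their sum vanishes. This
  serves the primes below the threshold \<open>64 * q\<close>.\<close>

lemma pigeonhole_zero_sum:
  assumes "finite R" "p * p ^ card I \<le> card R"
  shows "\<exists>T\<subseteq>R. card T = p \<and> (\<forall>i\<in>I. int p dvd (\<Sum>t\<in>T. a t i))"
proof -
  have "R \<noteq> {}" using assms(2) p_pos by auto
  have "\<exists>y\<in>box. p \<le> card ((\<lambda>t. red (a t)) -` {y} \<inter> R)"
  proof (rule ccontr)
    assume "\<not> ?thesis"
    then have less: "card ((\<lambda>t. red (a t)) -` {y} \<inter> R) < p" if "y \<in> box" for y using that by auto
    have "R = (\<Union>y\<in>box. (\<lambda>t. red (a t)) -` {y} \<inter> R)" using red_in_box by auto
    then have "card R \<le> (\<Sum>y\<in>box. card ((\<lambda>t. red (a t)) -` {y} \<inter> R))"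
      using card_UN_le[OF finite_box, of "\<lambda>y. (\<lambda>t. red (a t)) -` {y} \<inter> R"] by simp
    also have "\<dots> < (\<Sum>y\<in>box. p)"
      using less finite_box red_in_box by (intro sum_strict_mono) auto
    finally show False using assms(2) by (simp add: card_box mult.commute)
  qed
  then obtain y where "y \<in> box" and y: "p \<le> card ((\<lambda>t. red (a t)) -` {y} \<inter> R)" by blast
  obtain T where T: "T \<subseteq> (\<lambda>t. red (a t)) -` {y} \<inter> R" "card T = p" "finite T"
    using y by (rule obtain_subset_with_card_n)
  have "int p dvd (\<Sum>t\<in>T. a t i)" if "i \<in> I" for i
  proof -
    have "int p dvd a t i - y i" if "t \<in> T" for t
    proof -
      have "red (a t) = red y" using that T \<open>y \<in> box\<close> red_box by auto
      then show ?thesis using \<open>i \<in> I\<close> red_eq_iff by blast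
    qed
    then have "int p dvd (\<Sum>t\<in>T. a t i - y i)" by (intro dvd_sum)
    then show ?thesis using T by (simp add: sum_subtractf dvd_diff_left_iff)
  qed
  then show ?thesis using T by blast
qed

end

text \<open>If the terms are not thin, many lie on one hyperplane \<open>ip u = c\<close>; dropping
  a coordinate \<open>i\<close> where \<open>u\<close> is nonzero, the induction hypothesis handles
  the others. As the length is exactly \<open>p\<close>, the offsets \<open>c\<close> add up to 0
  modulo \<open>p\<close>, so coordinate \<open>i\<close> vanishes too.\<close>

theorem zero_sum_prime:
  "\<exists>C. \<forall>p I J (a :: nat \<Rightarrow> nat \<Rightarrow> int). prime p \<longrightarrow> finite I \<longrightarrow> card I = d \<longrightarrow> finite J \<longrightarrow> C * p \<le> card J \<longrightarrow>
    (\<exists>T\<subseteq>J. card T = p \<and> (\<forall>i\<in>(I :: nat set). int p dvd (\<Sum>t\<in>T. a t i)))"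
proof (induction d)
  case 0
  show ?case
  proof (intro exI[of _ 1] allI impI)
    fix p :: nat and I J :: "nat set" and a :: "nat \<Rightarrow> nat \<Rightarrow> int"
    assume "finite I" "card I = 0" "1 * p \<le> card J"
    then show "\<exists>T\<subseteq>J. card T = p \<and> (\<forall>i\<in>I. int p dvd (\<Sum>t\<in>T. a t i))"
      by (metis card_0_eq empty_iff mult_1 obtain_subset_with_card_n)
  qed
next
  case (Suc d)
  then obtain C where C: "\<And>p I J (a :: nat \<Rightarrow> nat \<Rightarrow> int). prime p \<Longrightarrow> finite I \<Longrightarrow> card I = d \<Longrightarrow>
      finite J \<Longrightarrow> C * p \<le> card J \<Longrightarrow>
      \<exists>T\<subseteq>J. card T = p \<and> (\<forall>i\<in>(I :: nat set). int p dvd (\<Sum>t\<in>T. a t i))"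
    by metis
  define q where "q = 64 * Suc d ^ 3 + 1"
  show ?case
  \<comment> \<open>The first two summands pay for the thin case with \<open>h = C * p\<close>, the
    last one for the pigeonhole argument when \<open>p\<close> is below
    \<open>64 * q\<close>.\<close>
  proof (intro exI[of _ "1024 * q * C + 4 + (64 * q) ^ Suc d"] allI impI)
    fix p :: nat and I J :: "nat set" and a :: "nat \<Rightarrow> nat \<Rightarrow> int"
    assume p: "prime p" and I: "finite I" "card I = Suc d" and J: "finite J"
      and card: "(1024 * q * C + 4 + (64 * q) ^ Suc d) * p \<le> card J"
    interpret prime_vectors p I by unfold_locales fact+
    have card': "1024 * q * (C * p) + 4 * p + (64 * q) ^ Suc d * p \<le> card J"
      using card by (simp add: algebra_simps)
    show "\<exists>T\<subseteq>J. card T = p \<and> (\<forall>i\<in>I. int p dvd (\<Sum>t\<in>T. a t i))"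
    proof (cases "64 * q \<le> p")
      case False
      then have "p ^ Suc d \<le> (64 * q) ^ Suc d" by (intro power_mono) auto
      then have "p ^ Suc d * p \<le> (64 * q) ^ Suc d * p" by (rule mult_right_mono) simp
      then have "p * p ^ card I \<le> card J"
        unfolding I(2) mult.commute[of p] using card' by linarith
      then show ?thesis by (rule pigeonhole_zero_sum[OF J])
    next
      case large: True
      show ?thesis
      proof (cases "thin a J (C * p)")
        case True
        have "1024 * q * (C * p) + 3 * p + 1 \<le> card J" using card' p_pos by linarith
        then show ?thesis
          using I q_def by (intro thin_zero_sum[OF J True _ _ large]) auto
      next
        case False
        then obtain u c i where i: "i \<in> I" "\<not> int p dvd u i"
          and many: "C * p \<le> card {x \<in> J. int p dvd ip u (a x) - c}"
          unfolding thin_def by (auto simp: not_le intro: less_imp_le)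
        let ?J = "{x \<in> J. int p dvd ip u (a x) - c}"
        obtain T where T: "T \<subseteq> ?J" "card T = p" and dvd: "\<And>k. k \<in> I - {i} \<Longrightarrow> int p dvd (\<Sum>t\<in>T. a t k)"
          using C[OF p, of "I - {i}" ?J a] I J i many by auto
        have "int p dvd (\<Sum>t\<in>T. ip u (a t) - c)" using T by (intro dvd_sum) auto
        then have "int p dvd (\<Sum>t\<in>T. ip u (a t))"
          using T by (simp add: sum_subtractf dvd_diff_left_iff)
        also have "(\<Sum>t\<in>T. ip u (a t)) = (\<Sum>k\<in>I. u k * (\<Sum>t\<in>T. a t k))"
          unfolding ip_def by (subst sum.swap) (simp add: sum_distrib_left)
        also have "\<dots> = u i * (\<Sum>t\<in>T. a t i) + (\<Sum>k\<in>I - {i}. u k * (\<Sum>t\<in>T. a t k))"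
          using i I by (simp add: sum.remove)
        finally have *: "int p dvd u i * (\<Sum>t\<in>T. a t i) + (\<Sum>k\<in>I - {i}. u k * (\<Sum>t\<in>T. a t k))" .
        have "int p dvd (\<Sum>k\<in>I - {i}. u k * (\<Sum>t\<in>T. a t k))"
          by (rule dvd_sum, rule dvd_mult, rule dvd)
        with * have "int p dvd u i * (\<Sum>t\<in>T. a t i)" by (simp only: dvd_add_left_iff)
        then have "int p dvd (\<Sum>t\<in>T. a t i)"
          using i p by (simp add: prime_dvd_mult_iff)
        then show ?thesis using T dvd by blast
      qed
    qed
  qed
qed

section \<open>Zero-sum bounds for integer vectors\<close>

text \<open>
  Elements of \<open>C\<^sub>n\<^sup>r\<close> are represented by integer vectors that are only relevant modulo \<open>n\<close> and in their
  first \<open>r\<close> coordinates, sequences by families over a finite index set; \<open>P\<close> constrains the length of the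
  zero-sum subsequence.
\<close>

definition zs_bound :: "(nat \<Rightarrow> bool) \<Rightarrow> nat \<Rightarrow> nat \<Rightarrow> nat \<Rightarrow> bool"
  where "zs_bound P n r t \<longleftrightarrow>
    (\<forall>J (a :: nat \<Rightarrow> nat \<Rightarrow> int). finite J \<longrightarrow> t \<le> card J \<longrightarrow>
      (\<exists>T\<subseteq>J. T \<noteq> {} \<and> P (card T) \<and> (\<forall>i<r. int n dvd (\<Sum>t\<in>T. a t i))))"

lemma zs_boundD:
  fixes a :: "nat \<Rightarrow> nat \<Rightarrow> int"
  assumes "zs_bound P n r t" "finite J" "t \<le> card J"
  shows "\<exists>T\<subseteq>J. T \<noteq> {} \<and> P (card T) \<and> (\<forall>i<r. int n dvd (\<Sum>t\<in>T. a t i))"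
  using spec[OF spec[OF assms(1)[unfolded zs_bound_def], of J], of a] assms(2,3) by simp

section \<open>Olson's theorem for prime powers\<close>

text \<open>The alternating sum is an iterated difference of order \<open>card J\<close>, applied to
  a product of only \<open>card K\<close> linear factors. Each difference lowers the degree.\<close>

lemma alternating_sum_prod:
  fixes c :: "'k \<Rightarrow> int" and w :: "'k \<Rightarrow> nat \<Rightarrow> int"
  assumes "finite J" "finite K" "card K < card J"
  shows "(\<Sum>T\<in>Pow J. (-1) ^ card T * (\<Prod>k\<in>K. c k + (\<Sum>x\<in>T. w k x))) = 0"
  using assms
proof (induction J arbitrary: K rule: finite_induct)
  case empty
  then show ?case by simp
next
  case (insert y J)
  let ?g = "\<lambda>k T. c k + (\<Sum>x\<in>T. w k x)"
  have fin: "finite T" "y \<notin> T" if "T \<in> Pow J" for T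
    using that insert.hyps finite_subset by auto
  \<comment> \<open>Adjoining \<open>y\<close> reproduces the old product, which cancels by sign,
    plus products over proper subsets \<open>X\<close> of \<open>K\<close>, to which the induction
    hypothesis applies.\<close>
  have split: "(\<Prod>k\<in>K. ?g k (insert y T)) = (\<Prod>k\<in>K. ?g k T) +
      (\<Sum>X\<in>Pow K - {K}. (\<Prod>k\<in>K - X. w k y) * (\<Prod>k\<in>X. ?g k T))" if "T \<in> Pow J" for T
  proof -
    have "(\<Prod>k\<in>K. ?g k (insert y T)) = (\<Prod>k\<in>K. ?g k T + w k y)"
      using fin[OF that] by (simp add: ac_simps)
    also have "\<dots> = (\<Sum>X\<in>Pow K. (\<Prod>k\<in>X. ?g k T) * (\<Prod>k\<in>K - X. w k y))"
      using insert.prems by (intro prod_add) auto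
    also have "\<dots> = (\<Prod>k\<in>K. ?g k T) * (\<Prod>k\<in>K - K. w k y) +
        (\<Sum>X\<in>Pow K - {K}. (\<Prod>k\<in>X. ?g k T) * (\<Prod>k\<in>K - X. w k y))"
      using insert.prems by (intro sum.remove) auto
    finally show ?thesis by (simp add: mult.commute)
  qed
  have inj: "inj_on (insert y) (Pow J)"
    using insert.hyps by (auto simp: inj_on_def)
  have disj: "Pow J \<inter> insert y ` Pow J = {}" using insert.hyps by auto
  have "(\<Sum>T\<in>Pow (insert y J). (-1) ^ card T * (\<Prod>k\<in>K. ?g k T)) =
      (\<Sum>T\<in>Pow J. (-1) ^ card T * (\<Prod>k\<in>K. ?g k T)) +
      (\<Sum>T\<in>Pow J. (-1) ^ card (insert y T) * (\<Prod>k\<in>K. ?g k (insert y T)))"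
    unfolding Pow_insert using insert.hyps disj inj
    by (subst sum.union_disjoint) (auto simp: sum.reindex)
  also have "(\<Sum>T\<in>Pow J. (-1) ^ card (insert y T) * (\<Prod>k\<in>K. ?g k (insert y T))) =
      (\<Sum>T\<in>Pow J. - ((-1) ^ card T * (\<Prod>k\<in>K. ?g k T)) -
        (\<Sum>X\<in>Pow K - {K}. (\<Prod>k\<in>K - X. w k y) * ((-1) ^ card T * (\<Prod>k\<in>X. ?g k T))))"
  proof (rule sum.cong[OF refl])
    fix T assume T: "T \<in> Pow J"
    have "(-1) ^ card (insert y T) = - ((-1) ^ card T :: int)"
      using fin[OF T] by simp
    then show "(-1) ^ card (insert y T) * (\<Prod>k\<in>K. ?g k (insert y T)) =
      - ((-1) ^ card T * (\<Prod>k\<in>K. ?g k T)) -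
        (\<Sum>X\<in>Pow K - {K}. (\<Prod>k\<in>K - X. w k y) * ((-1) ^ card T * (\<Prod>k\<in>X. ?g k T)))"
      unfolding split[OF T] by (simp only: distrib_left sum_distrib_left) (simp add: ac_simps sum_negf)
  qed
  also have "\<dots> = - (\<Sum>T\<in>Pow J. (-1) ^ card T * (\<Prod>k\<in>K. ?g k T)) -
      (\<Sum>X\<in>Pow K - {K}. (\<Prod>k\<in>K - X. w k y) * (\<Sum>T\<in>Pow J. (-1) ^ card T * (\<Prod>k\<in>X. ?g k T)))"
    unfolding sum_subtractf sum_negf sum_distrib_left by (simp add: sum.swap[of _ "Pow K - {K}"])
  also have "(\<Sum>X\<in>Pow K - {K}. (\<Prod>k\<in>K - X. w k y) * (\<Sum>T\<in>Pow J. (-1) ^ card T * (\<Prod>k\<in>X. ?g k T))) = 0"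
  proof (intro sum.neutral ballI)
    fix X assume "X \<in> Pow K - {K}"
    then have X: "X \<subset> K" by auto
    then have "card X < card K" using insert.prems by (intro psubset_card_mono)
    then have "card X < card J" using insert.prems insert.hyps by simp
    moreover have "finite X" using X insert.prems finite_subset by blast
    ultimately show "(\<Prod>k\<in>K - X. w k y) * (\<Sum>T\<in>Pow J. (-1) ^ card T * (\<Prod>k\<in>X. ?g k T)) = 0"
      using insert.IH by simp
  qed
  finally show ?case by simp
qed

text \<open>With \<open>p ^ k = Suc m\<close>, absorption shows that \<open>p ^ k\<close> divides
  \<open>s * ((s + m) choose m)\<close>. A binomial prime to \<open>p\<close> would leave all of
  \<open>p ^ k\<close> to \<open>s\<close>.\<close>

lemma prime_dvd_binomial:
  fixes p k s :: nat
  assumes "prime p" "\<not> p ^ k dvd s"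
  shows "p dvd (s + (p ^ k - 1)) choose (p ^ k - 1)"
proof (rule ccontr)
  assume ndvd: "\<not> p dvd (s + (p ^ k - 1)) choose (p ^ k - 1)"
  obtain m where m: "p ^ k = Suc m"
    using assms(1) prime_gt_0_nat by (metis gr0_implies_Suc zero_less_power)
  have "s * ((s + m) choose m) = Suc m * ((s + m) choose Suc m)"
    using binomial_absorb_comp[of "s + m" m] binomial_absorption[of m "s + m"] by simp
  then have "p ^ k dvd s * ((s + m) choose m)" unfolding m by (metis dvd_triv_left)
  moreover have "coprime (p ^ k) ((s + m) choose m)"
    using ndvd[unfolded m] prime_imp_coprime[OF assms(1)] by simp
  ultimately show False using assms(2) by (simp add: coprime_dvd_mult_left_iff)
qed

text \<open>Clearing the denominator exhibits the weight in Olson's argument as a product of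
  \<open>m\<close> linear factors in \<open>s\<close>.\<close>

lemma fact_mult_binomial_shift:
  "int (fact m) * int ((s + m) choose m) = (\<Prod>k<m. int k + 1 + int s)"
proof -
  have "fact s * (\<Prod>k<m. k + 1 + s) = (fact (s + m) :: nat)"
    by (induction m) (simp_all add: algebra_simps)
  then have "fact s * (\<Prod>k<m. k + 1 + s) = fact s * (fact m * ((s + m) choose m))"
    using binomial_fact_lemma[of m "s + m"] by (simp add: ac_simps)
  then have "fact m * ((s + m) choose m) = (\<Prod>k<m. k + 1 + s)"
    by simp
  then have "int (fact m * ((s + m) choose m)) = int (\<Prod>k<m. k + 1 + s)" by simp
  then show ?thesis by (simp add: ac_simps)
qed

text \<open>
  Olson's theorem. The weight \<open>\<Prod>j. (s\<^sub>j + q - 1) choose (q - 1)\<close>, where \<open>s\<^sub>j\<close> is the \<open>j\<close>-th coordinate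
  of a subsum, is divisible by \<open>p\<close> unless the subsum vanishes modulo \<open>q = p ^ k\<close>, and as a
  polynomial of degree \<open>r * (q - 1)\<close> its alternating sum over all subsums is zero.
\<close>

theorem zs_bound_prime_power:
  assumes p: "prime p" and q: "q = p ^ k"
  shows "zs_bound (\<lambda>_. True) q r (r * (q - 1) + 1)"
  unfolding zs_bound_def
proof (intro allI impI, rule ccontr)
  fix J :: "nat set" and a :: "nat \<Rightarrow> nat \<Rightarrow> int"
  assume J: "finite J" "r * (q - 1) + 1 \<le> card J"
    and none: "\<not> (\<exists>T\<subseteq>J. T \<noteq> {} \<and> True \<and> (\<forall>i<r. int q dvd (\<Sum>t\<in>T. a t i)))"
  have q0: "0 < q" using p q prime_gt_0_nat by simp
  \<comment> \<open>Nonnegative representatives make the subsums natural numbers, as the binomial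
    coefficients require.\<close>
  define w where "w = (\<lambda>i x. nat (a x i mod int q))"
  have w: "int (w i x) = a x i mod int q" for i x using q0 by (simp add: w_def)
  let ?s = "\<lambda>i T. \<Sum>x\<in>T. w i x"
  let ?b = "\<lambda>i T. (?s i T + (q - 1)) choose (q - 1)"
  have dvd_iff: "q dvd ?s i T \<longleftrightarrow> int q dvd (\<Sum>x\<in>T. a x i)" for i T
  proof -
    have "int (?s i T) mod int q = (\<Sum>x\<in>T. a x i) mod int q"
      by (simp add: w mod_sum_eq)
    then show ?thesis
      by (metis dvd_eq_mod_eq_0 int_dvd_int_iff)
  qed
  have expand: "(\<Prod>i<r. int (fact (q - 1)) * int (?b i T)) =
      (\<Prod>(i, k)\<in>{..<r} \<times> {..<q - 1}. int k + 1 + (\<Sum>x\<in>T. int (w i x)))" for T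
    unfolding fact_mult_binomial_shift prod.cartesian_product[symmetric] by simp
  have "(\<Sum>T\<in>Pow J. (-1) ^ card T * (\<Prod>(i, k)\<in>{..<r} \<times> {..<q - 1}. int k + 1 + (\<Sum>x\<in>T. int (w i x)))) = 0"
    using alternating_sum_prod[OF J(1), of "{..<r} \<times> {..<q - 1}" "\<lambda>(i, k). int k + 1" "\<lambda>(i, k) x. int (w i x)"]
      J(2) by (simp add: case_prod_beta)
  then have "int (fact (q - 1)) ^ r * (\<Sum>T\<in>Pow J. (-1) ^ card T * (\<Prod>i<r. int (?b i T))) = 0"
    unfolding expand[symmetric] prod.distrib by (simp add: sum_distrib_left ac_simps)
  then have zero: "(\<Sum>T\<in>Pow J. (-1) ^ card T * (\<Prod>i<r. int (?b i T))) = 0" by simp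
  \<comment> \<open>The empty set has weight 1 and every other subset has weight divisible by
    \<open>p\<close>, so the total cannot be zero.\<close>
  define X where "X = (\<Sum>T\<in>Pow J - {{}}. (-1) ^ card T * (\<Prod>i<r. int (?b i T)))"
  have "(\<Sum>T\<in>Pow J. (-1) ^ card T * (\<Prod>i<r. int (?b i T))) = 1 + X"
    unfolding X_def using J by (subst sum.remove[of _ "{}"]) auto
  then have "1 = - X" using zero by simp
  moreover have "int p dvd X"
    unfolding X_def
  proof (intro dvd_sum dvd_mult)
    fix T assume "T \<in> Pow J - {{}}"
    then have "\<exists>i<r. \<not> int q dvd (\<Sum>x\<in>T. a x i)" using none by blast
    then obtain i where i: "i < r" "\<not> q dvd ?s i T"
      unfolding dvd_iff by blast
    have "p dvd ?b i T"
      using prime_dvd_binomial[OF p, of k "?s i T"] i(2) unfolding q by simp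
    then have "int p dvd int (?b i T)" by simp
    also have "\<dots> dvd (\<Prod>i<r. int (?b i T))" using i by (intro dvd_prodI) auto
    finally show "int p dvd (\<Prod>i<r. int (?b i T))" .
  qed
  ultimately have "int p dvd 1" by simp
  then show False using p by (simp add: prime_nat_iff)
qed

section \<open>From the factors of a modulus to their product\<close>

text \<open>Greedy removal: each set found takes at most \<open>m\<close> terms, so after
  \<open>k\<close> removals \<open>t\<close> terms remain for one more. The indices
  \<open>l \<le> k\<close> thus give \<open>k + 1\<close> sets.\<close>

lemma extraction:
  fixes a :: "nat \<Rightarrow> nat \<Rightarrow> int"
  assumes "zs_bound (\<lambda>c. c \<le> m) m r t" "finite J" "k * m + t \<le> card J"
  shows "\<exists>F. (\<forall>l\<le>k. F l \<subseteq> J \<and> F l \<noteq> {} \<and> card (F l) \<le> m \<and> (\<forall>i<r. int m dvd (\<Sum>x\<in>F l. a x i))) \<and>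
    (\<forall>l\<le>k. \<forall>l'\<le>k. l \<noteq> l' \<longrightarrow> F l \<inter> F l' = {})"
  using assms(2,3)
proof (induction k arbitrary: J)
  case 0
  then have "t \<le> card J" by simp
  from zs_boundD[OF assms(1) 0(1) this, of a] obtain T where
    "T \<subseteq> J" "T \<noteq> {}" "card T \<le> m" "\<And>i. i < r \<Longrightarrow> int m dvd (\<Sum>x\<in>T. a x i)"
    by blast
  then show ?case by (intro exI[of _ "\<lambda>_. T"]) simp
next
  case (Suc k)
  then have "t \<le> card J" by simp
  from zs_boundD[OF assms(1) Suc.prems(1) this, of a]
  obtain T where T: "T \<subseteq> J" "T \<noteq> {}" "card T \<le> m" "\<And>i. i < r \<Longrightarrow> int m dvd (\<Sum>x\<in>T. a x i)"
    by blast
  have "card (J - T) = card J - card T"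
    using T Suc.prems finite_subset by (intro card_Diff_subset) auto
  then have "k * m + t \<le> card (J - T)" using T(3) Suc.prems(2) by simp
  with Suc.IH[of "J - T"] Suc.prems(1) obtain F where
    F: "\<forall>l\<le>k. F l \<subseteq> J - T \<and> F l \<noteq> {} \<and> card (F l) \<le> m \<and> (\<forall>i<r. int m dvd (\<Sum>x\<in>F l. a x i))"
      "\<forall>l\<le>k. \<forall>l'\<le>k. l \<noteq> l' \<longrightarrow> F l \<inter> F l' = {}"
    by auto
  show ?case
    using F T by (intro exI[of _ "F(Suc k := T)"]) (auto simp: le_Suc_eq; blast)
qed

text \<open>The extracted sums, divided by \<open>m\<close>, form \<open>k + 1\<close> vectors to be
  treated modulo \<open>q\<close>. The general \<open>P\<close> and \<open>Q\<close> serve both the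
  bound for short subsequences and the one without a length restriction.\<close>

lemma zs_bound_mult:
  assumes m: "zs_bound (\<lambda>c. c \<le> m) m r t" "0 < m"
    and q: "zs_bound P q r (Suc k)"
    and Q: "\<And>c e. P c \<Longrightarrow> e \<le> c * m \<Longrightarrow> Q e"
  shows "zs_bound Q (m * q) r (k * m + t)"
  unfolding zs_bound_def
proof (intro allI impI)
  fix J :: "nat set" and a :: "nat \<Rightarrow> nat \<Rightarrow> int"
  assume J: "finite J" "k * m + t \<le> card J"
  obtain F where
    F_all: "\<forall>l\<le>k. F l \<subseteq> J \<and> F l \<noteq> {} \<and> card (F l) \<le> m \<and> (\<forall>i<r. int m dvd (\<Sum>x\<in>F l. a x i))"
    and disj: "\<forall>l\<le>k. \<forall>l'\<le>k. l \<noteq> l' \<longrightarrow> F l \<inter> F l' = {}"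
    using extraction[OF m(1) J, of a] by blast
  have F: "F l \<subseteq> J" "F l \<noteq> {}" "card (F l) \<le> m" "\<forall>i<r. int m dvd (\<Sum>x\<in>F l. a x i)" if "l \<le> k" for l
    using F_all that by blast+
  define b where "b = (\<lambda>l i. (\<Sum>x\<in>F l. a x i) div int m)"
  have "finite {..k}" "Suc k \<le> card {..k}" by auto
  from zs_boundD[OF q this, of b] obtain L where
    L: "L \<subseteq> {..k}" "L \<noteq> {}" "P (card L)" "\<And>i. i < r \<Longrightarrow> int q dvd (\<Sum>l\<in>L. b l i)"
    by blast
  let ?T = "\<Union>l\<in>L. F l"
  have finL: "finite L" using L finite_subset by blast
  have finF: "finite (F l)" if "l \<in> L" for l using that L(1) F(1) J(1) finite_subset by blast
  have "card ?T \<le> (\<Sum>l\<in>L. card (F l))" using finL by (rule card_UN_le)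
  also have "\<dots> \<le> (\<Sum>l\<in>L. m)" using L F(3) by (intro sum_mono) auto
  finally have "Q (card ?T)" using Q[OF L(3)] by simp
  moreover have FL: "F l \<subseteq> J" "F l \<noteq> {}" if "l \<in> L" for l
    using that L(1) F(1,2)[of l] by auto
  have "?T \<subseteq> J" using FL(1) by (rule UN_least)
  moreover have "?T \<noteq> {}" using L(2) FL(2) by simp
  moreover have "int (m * q) dvd (\<Sum>x\<in>?T. a x i)" if "i < r" for i
  proof -
    have "(\<Sum>x\<in>?T. a x i) = (\<Sum>l\<in>L. \<Sum>x\<in>F l. a x i)"
      using finL finF L(1) disj by (intro sum.UNION_disjoint) (auto simp: subset_iff)
    also have "\<dots> = (\<Sum>l\<in>L. int m * b l i)"
      unfolding b_def using L(1) F(4) that by (intro sum.cong) auto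
    also have "\<dots> = int m * (\<Sum>l\<in>L. b l i)" by (simp add: sum_distrib_left)
    finally show ?thesis using L(4)[OF that] by simp
  qed
  ultimately show "\<exists>T\<subseteq>J. T \<noteq> {} \<and> Q (card T) \<and> (\<forall>i<r. int (m * q) dvd (\<Sum>x\<in>T. a x i))"
    by (intro exI[of _ ?T]) blast
qed

text \<open>The form \<open>c * (n - 1) + 1\<close> is reproduced exactly by
  \<open>zs_bound_mult\<close>, since
  \<open>c * (p - 1) * m + c * (m - 1) = c * (m * p - 1)\<close>. One constant for all primes
  therefore serves all \<open>n\<close>.\<close>

theorem zs_bound_linear: "\<exists>c. \<forall>n\<ge>1. zs_bound (\<lambda>e. e \<le> n) n r (c * (n - 1) + 1)"
proof -
  obtain C where C: "\<And>p I J (a :: nat \<Rightarrow> nat \<Rightarrow> int). prime p \<Longrightarrow> finite I \<Longrightarrow> card I = r \<Longrightarrow>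
      finite J \<Longrightarrow> C * p \<le> card J \<Longrightarrow>
      \<exists>T\<subseteq>J. card T = p \<and> (\<forall>i\<in>(I :: nat set). int p dvd (\<Sum>t\<in>T. a t i))"
    using zero_sum_prime[of r] by metis
  have prime_case: "zs_bound (\<lambda>e. e \<le> p) p r (Suc (2 * C * (p - 1)))" if p: "prime p" for p
    unfolding zs_bound_def
  proof (intro allI impI)
    fix J :: "nat set" and a :: "nat \<Rightarrow> nat \<Rightarrow> int"
    assume J: "finite J" "Suc (2 * C * (p - 1)) \<le> card J"
    \<comment> \<open>Doubling the constant trades the bound \<open>C * p\<close> for a multiple of
      \<open>p - 1\<close>.\<close>
    have "p \<le> 2 * (p - 1)" using prime_ge_2_nat[OF p] by simp
    then have "C * p \<le> C * (2 * (p - 1))" by (rule mult_le_mono2)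
    also have "C * (2 * (p - 1)) = 2 * C * (p - 1)" by simp
    finally have "C * p \<le> card J" using J(2) by linarith
    then obtain T where T: "T \<subseteq> J" "card T = p" "\<forall>i\<in>{..<r}. int p dvd (\<Sum>t\<in>T. a t i)"
      using C[OF p, of "{..<r}" J a] J(1) by auto
    moreover have "T \<noteq> {}" using T(2) prime_gt_0_nat[OF p] by auto
    ultimately show "\<exists>T\<subseteq>J. T \<noteq> {} \<and> card T \<le> p \<and> (\<forall>i<r. int p dvd (\<Sum>t\<in>T. a t i))"
      by (intro exI[of _ T]) auto
  qed
  have "zs_bound (\<lambda>e. e \<le> n) n r (2 * C * (n - 1) + 1)" if "n \<ge> 1" for n
    using that
  proof (induction n rule: less_induct)
    case (less n)
    show ?case
    proof (cases "n = 1")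
      case True
      show ?thesis
        unfolding zs_bound_def True
      proof (intro allI impI)
        fix J :: "nat set" and a :: "nat \<Rightarrow> nat \<Rightarrow> int"
        assume "2 * C * (1 - 1) + 1 \<le> card J"
        then obtain x where "x \<in> J" by fastforce
        then show "\<exists>T\<subseteq>J. T \<noteq> {} \<and> card T \<le> 1 \<and> (\<forall>i<r. int 1 dvd (\<Sum>t\<in>T. a t i))"
          by (intro exI[of _ "{x}"]) auto
      qed
    next
      case False
      then obtain p m where p: "prime p" and n: "n = m * p"
        by (metis dvd_def mult.commute prime_factor_nat)
      have p2: "2 \<le> p" using p by (rule prime_ge_2_nat)
      have m: "0 < m" "m < n" using n less.prems p2 by (auto intro: gr0I)
      have "zs_bound (\<lambda>e. e \<le> m) m r (2 * C * (m - 1) + 1)"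
        using less.IH m by simp
      then have "zs_bound (\<lambda>e. e \<le> n) (m * p) r (2 * C * (p - 1) * m + (2 * C * (m - 1) + 1))"
        by (rule zs_bound_mult[OF _ m(1) prime_case[OF p]])
          (simp add: n, metis mult.commute mult_le_mono2 order_trans)
      moreover have "2 * C * (p - 1) * m + (2 * C * (m - 1) + 1) = 2 * C * (n - 1) + 1"
      proof -
        obtain m' p' where "m = Suc m'" "p = Suc p'" using m p2 by (metis Suc_le_D gr0_implies_Suc numeral_2_eq_2)
        then show ?thesis by (simp add: n algebra_simps)
      qed
      ultimately show ?thesis by (simp only: n)
    qed
  qed
  then show ?thesis by blast
qed

section \<open>Zero-sum sequences over \<open>C\<^sub>n\<^sup>r\<close>\<close>

lemma (in comm_monoid) seq_sum_superset:
  assumes "finite A" "set_mset S \<subseteq> A" "A \<subseteq> carrier G"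
  shows "seq_sum G S = finprod G (\<lambda>x. x [^] count S x) A"
  unfolding seq_sum_def
  using assms by (intro finprod_mono_neutral_cong_left) (auto simp: not_in_iff)

text \<open>As \<open>x\<close> may already occur in \<open>S\<close>, both products are taken over
  the same index set before one factor \<open>x\<close> is split off.\<close>

lemma (in comm_monoid) seq_sum_add_mset:
  assumes "sequence_over G (add_mset x S)"
  shows "seq_sum G (add_mset x S) = x \<otimes> seq_sum G S"
proof -
  let ?A = "insert x (set_mset S)"
  have A: "?A \<subseteq> carrier G" "x \<in> carrier G" using assms by (auto simp: sequence_over_def)
  have "seq_sum G (add_mset x S) = finprod G (\<lambda>y. y [^] count (add_mset x S) y) ?A"
    using A by (intro seq_sum_superset) auto
  also have "\<dots> = finprod G (\<lambda>y. (if x = y then y else \<one>) \<otimes> y [^] count S y) ?A"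
  proof (rule finprod_cong')
    show "y [^] count (add_mset x S) y = (if x = y then y else \<one>) \<otimes> y [^] count S y"
      if "y \<in> ?A" for y
    proof -
      have "y \<in> carrier G" using that A by blast
      then show ?thesis by (simp add: m_comm)
    qed
  qed (use A in auto)
  also have "\<dots> = finprod G (\<lambda>y. if x = y then y else \<one>) ?A \<otimes> finprod G (\<lambda>y. y [^] count S y) ?A"
    using A by (intro finprod_multf) auto
  also have "finprod G (\<lambda>y. if x = y then y else \<one>) ?A = x"
    using A by (intro finprod_singleton) auto
  also have "finprod G (\<lambda>y. y [^] count S y) ?A = seq_sum G S"
    using A by (intro seq_sum_superset[symmetric]) auto
  finally show ?thesis .
qed

lemma carrier_cyclic_power: "n \<ge> 1 \<Longrightarrow> carrier (cyclic_power n r) = (\<Pi>\<^sub>E i\<in>{..<r}. {0..<int n})"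
  by (simp add: cyclic_power_def carrier_integer_mod_group)

lemma mult_cyclic_power: "x \<otimes>\<^bsub>cyclic_power n r\<^esub> y = (\<lambda>i\<in>{..<r}. (x i + y i) mod int n)"
  by (simp add: cyclic_power_def)

lemma one_cyclic_power: "\<one>\<^bsub>cyclic_power n r\<^esub> = (\<lambda>i\<in>{..<r}. 0)"
  by (simp add: cyclic_power_def)

lemma comm_group_cyclic_power: "comm_group (cyclic_power n r)"
proof (rule group.group_comm_groupI)
  show "group (cyclic_power n r)" by (simp add: cyclic_power_def)
qed (simp add: mult_cyclic_power add.commute)

lemma seq_sum_cyclic_power:
  assumes "sequence_over (cyclic_power n r) S"
  shows "seq_sum (cyclic_power n r) S = (\<lambda>i\<in>{..<r}. (\<Sum>x\<in>#S. x i) mod int n)"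
  using assms
proof (induction S)
  case empty
  interpret comm_group "cyclic_power n r" by (rule comm_group_cyclic_power)
  show ?case by (simp add: seq_sum_def one_cyclic_power)
next
  case (add x S)
  interpret comm_group "cyclic_power n r" by (rule comm_group_cyclic_power)
  have "sequence_over (cyclic_power n r) S" using add.prems by (simp add: sequence_over_def)
  with add.IH show ?case
    unfolding seq_sum_add_mset[OF add.prems] mult_cyclic_power
    by (auto simp: fun_eq_iff mod_add_right_eq)
qed

lemma zero_sum_cyclic_power:
  assumes "sequence_over (cyclic_power n r) S"
  shows "zero_sum (cyclic_power n r) S \<longleftrightarrow> (\<forall>i<r. int n dvd (\<Sum>x\<in>#S. x i))"
  unfolding zero_sum_def seq_sum_cyclic_power[OF assms] one_cyclic_power
  by (auto simp: fun_eq_iff restrict_def dvd_eq_mod_eq_0)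

lemma pow_cyclic_power:
  fixes e :: nat
  shows "x [^]\<^bsub>cyclic_power n r\<^esub> e = (\<lambda>i\<in>{..<r}. (int e * x i) mod int n)"
proof (induction e)
  case 0
  then show ?case by (simp add: one_cyclic_power)
next
  case (Suc e)
  then show ?case
    by (auto simp: mult_cyclic_power fun_eq_iff mod_simps algebra_simps)
qed

lemma group_exp_cyclic_power:
  assumes "n \<ge> 1" "r \<ge> 1"
  shows "group_exp (cyclic_power n r) = n"
  unfolding group_exp_def
proof (rule Least_equality)
  show "1 \<le> n \<and> (\<forall>x\<in>carrier (cyclic_power n r). x [^]\<^bsub>cyclic_power n r\<^esub> n = \<one>\<^bsub>cyclic_power n r\<^esub>)"
    using assms by (auto simp: pow_cyclic_power one_cyclic_power fun_eq_iff)
next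
  fix e :: nat assume e: "1 \<le> e \<and> (\<forall>x\<in>carrier (cyclic_power n r). x [^]\<^bsub>cyclic_power n r\<^esub> e = \<one>\<^bsub>cyclic_power n r\<^esub>)"
  define x :: "nat \<Rightarrow> int" where "x = (\<lambda>i\<in>{..<r}. 1 mod int n)"
  have "x \<in> carrier (cyclic_power n r)"
    using assms by (auto simp: carrier_cyclic_power x_def)
  then have "x [^]\<^bsub>cyclic_power n r\<^esub> e = \<one>\<^bsub>cyclic_power n r\<^esub>" using e by blast
  then have "(\<lambda>i\<in>{..<r}. (int e * x i) mod int n) = (\<lambda>i\<in>{..<r}. 0)"
    by (simp only: pow_cyclic_power one_cyclic_power)
  from fun_cong[OF this, of 0] have "(int e * x 0) mod int n = 0"
    using assms by simp
  then have "int e mod int n = 0"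
    using assms by (simp add: x_def mod_mult_right_eq)
  then have "n dvd e" by (metis dvd_eq_mod_eq_0 int_dvd_int_iff)
  then show "n \<le> e" using e by (intro dvd_imp_le) auto
qed

text \<open>The bridge between families of integer vectors and multisets of group elements: repeated
  terms correspond to distinct indices.\<close>

lemma zs_bound_cyclic_power:
  assumes "n \<ge> 1"
  shows "zs_bound P n r t \<longleftrightarrow>
    (\<forall>S. sequence_over (cyclic_power n r) S \<and> t \<le> size S \<longrightarrow>
      (\<exists>T. T \<subseteq># S \<and> T \<noteq> {#} \<and> zero_sum (cyclic_power n r) T \<and> P (size T)))"
proof (intro iffI allI impI)
  fix S assume zs: "zs_bound P n r t"
    and S: "sequence_over (cyclic_power n r) S \<and> t \<le> size S"
  obtain xs where xs: "mset xs = S" using ex_mset by blast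
  have image: "image_mset ((!) xs) (mset_set {..<length xs}) = S"
    unfolding xs[symmetric] by (metis atLeast_upt map_nth mset_map mset_upt lessThan_atLeast0)
  have "finite {..<length xs}" "t \<le> card {..<length xs}" using S xs by auto
  from zs_boundD[OF zs this, of "(!) xs"] obtain T where
    T: "T \<subseteq> {..<length xs}" "T \<noteq> {}" "P (card T)" "\<And>i. i < r \<Longrightarrow> int n dvd (\<Sum>t\<in>T. (xs ! t) i)"
    by blast
  have finT: "finite T" using T finite_subset by blast
  let ?M = "image_mset ((!) xs) (mset_set T)"
  have sub: "?M \<subseteq># S"
    unfolding image[symmetric] using T by (intro image_mset_subseteq_mono subset_imp_msubset_mset_set) auto
  then have "sequence_over (cyclic_power n r) ?M"
    using S set_mset_mono unfolding sequence_over_def by blast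
  moreover have "(\<Sum>x\<in>#?M. x i) = (\<Sum>t\<in>T. (xs ! t) i)" for i
    by (simp add: sum_unfold_sum_mset image_mset.compositionality comp_def)
  ultimately have "zero_sum (cyclic_power n r) ?M" using T(4) by (simp add: zero_sum_cyclic_power)
  then show "\<exists>T. T \<subseteq># S \<and> T \<noteq> {#} \<and> zero_sum (cyclic_power n r) T \<and> P (size T)"
    using sub T finT by (intro exI[of _ ?M]) (simp add: mset_set_empty_iff)
next
  assume *: "\<forall>S. sequence_over (cyclic_power n r) S \<and> t \<le> size S \<longrightarrow>
      (\<exists>T. T \<subseteq># S \<and> T \<noteq> {#} \<and> zero_sum (cyclic_power n r) T \<and> P (size T))"
  show "zs_bound P n r t"
    unfolding zs_bound_def
  proof (intro allI impI)
    fix J :: "nat set" and a :: "nat \<Rightarrow> nat \<Rightarrow> int"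
    assume J: "finite J" "t \<le> card J"
    let ?f = "\<lambda>t. \<lambda>i\<in>{..<r}. a t i mod int n"
    let ?S = "image_mset ?f (mset_set J)"
    have seq: "sequence_over (cyclic_power n r) ?S"
    proof -
      have "?f x \<in> carrier (cyclic_power n r)" for x
        unfolding carrier_cyclic_power[OF assms] restrict_PiE_iff using assms by simp
      then show ?thesis unfolding sequence_over_def by auto
    qed
    moreover have "t \<le> size ?S" using J by simp
    ultimately obtain M where M: "M \<subseteq># ?S" "M \<noteq> {#}" "zero_sum (cyclic_power n r) M" "P (size M)"
      using * by blast
    \<comment> \<open>The submultiset of the image is lifted to a submultiset \<open>N\<close> of
      \<open>mset_set J\<close>; having no repetitions, \<open>N\<close> is a set of
      indices.\<close>
    obtain M' where "?S = M + M'" using M(1) by (auto simp: subset_mset.le_iff_add)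
    then obtain N N' where N: "mset_set J = N + N'" "M = image_mset ?f N"
      using image_mset_eq_plusD by blast
    have "count N x \<le> 1" for x
    proof -
      have "count N x \<le> count (mset_set J) x" unfolding N(1) by simp
      also have "\<dots> \<le> 1" by (cases "x \<in> J") (auto simp: count_mset_set')
      finally show ?thesis .
    qed
    then have "N = mset_set (set_mset N)"
      by (intro multiset_eqI) (metis One_nat_def count_greater_zero_iff count_mset_set(1,3) finite_set_mset
          le_antisym le_zero_eq not_gr_zero Suc_leI)
    then obtain T where T: "N = mset_set T" "finite T" by blast
    have "set_mset N \<subseteq> set_mset (mset_set J)" unfolding N(1) by simp
    then have TJ: "T \<subseteq> J" using T J by simp
    have "sequence_over (cyclic_power n r) M"
      using seq set_mset_mono[OF M(1)] unfolding sequence_over_def by blast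
    then have dvd: "int n dvd (\<Sum>x\<in>#M. x i)" if "i < r" for i
      using M(3) that by (simp add: zero_sum_cyclic_power)
    have "int n dvd (\<Sum>t\<in>T. a t i)" if "i < r" for i
    proof -
      have "(\<Sum>x\<in>#M. x i) = (\<Sum>t\<in>T. a t i mod int n)"
        unfolding N(2) T(1) using that by (simp add: sum_unfold_sum_mset image_mset.compositionality comp_def)
      then have "(\<Sum>t\<in>T. a t i mod int n) mod int n = 0" using dvd[OF that] by simp
      then show ?thesis by (simp add: mod_sum_eq dvd_eq_mod_eq_0)
    qed
    moreover have "T \<noteq> {}" "P (card T)" using M(2,4) N(2) T by auto
    ultimately show "\<exists>T\<subseteq>J. T \<noteq> {} \<and> P (card T) \<and> (\<forall>i<r. int n dvd (\<Sum>t\<in>T. a t i))"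
      using TJ by blast
  qed
qed

section \<open>The invariants \<open>davenport\<close>, \<open>eta\<close> and
  \<open>c_const\<close>\<close>

lemma davenport_le:
  assumes "n \<ge> 1" "t \<ge> 1" "zs_bound (\<lambda>_. True) n r t"
  shows "davenport (cyclic_power n r) \<le> t"
  unfolding davenport_def
  using assms zs_bound_cyclic_power[of n "\<lambda>_. True" r t] by (intro Least_le) auto

lemma eta_altdef:
  assumes "n \<ge> 1" "r \<ge> 1"
  shows "eta (cyclic_power n r) = (LEAST t. t \<ge> 1 \<and> zs_bound (\<lambda>e. e \<le> n) n r t)"
  unfolding eta_def group_exp_cyclic_power[OF assms] zs_bound_cyclic_power[OF assms(1)] by simp

text \<open>The linear bound provides a witness, so that the \<open>LEAST\<close> defining
  \<open>eta\<close> is attained.\<close>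

lemma zs_bound_eta:
  assumes "n \<ge> 1" "r \<ge> 1"
  shows "zs_bound (\<lambda>e. e \<le> n) n r (eta (cyclic_power n r))"
proof -
  obtain c where "zs_bound (\<lambda>e. e \<le> n) n r (c * (n - 1) + 1)"
    using zs_bound_linear[of r] assms by blast
  then have "c * (n - 1) + 1 \<ge> 1 \<and> zs_bound (\<lambda>e. e \<le> n) n r (c * (n - 1) + 1)" by simp
  then show ?thesis unfolding eta_altdef[OF assms] by (rule LeastI2) blast
qed

text \<open>Over the reals \<open>LEAST\<close> is meaningful only for an attained minimum. Here it
  is the supremum \<open>m\<close> of the slopes for \<open>n \<ge> 2\<close>, finite because of
  \<open>C\<close>; the case \<open>n = 1\<close> only says that \<open>f 1\<close> is at most
  1.\<close>

lemma least_slope: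
  fixes f :: "nat \<Rightarrow> nat" and C :: real
  assumes C: "\<And>n. n \<ge> 1 \<Longrightarrow> real (f n) \<le> C * (real n - 1) + 1" and "n \<ge> 1"
  shows "real (f n) \<le> (LEAST c. \<forall>n\<ge>1. real (f n) \<le> c * (real n - 1) + 1) * (real n - 1) + 1"
proof -
  let ?P = "\<lambda>c. \<forall>n\<ge>1. real (f n) \<le> c * (real n - 1) + 1"
  let ?g = "\<lambda>n. (real (f n) - 1) / (real n - 1)"
  define m where "m = (SUP n\<in>{2..}. ?g n)"
  have P_iff: "?P c \<longleftrightarrow> (\<forall>n\<in>{2..}. ?g n \<le> c)" for c
  proof -
    have iff: "real (f n) \<le> c * (real n - 1) + 1 \<longleftrightarrow> ?g n \<le> c" if "n \<ge> 2" for n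
      using that by (simp add: field_simps)
    show ?thesis
    proof (intro iffI ballI allI impI)
      fix n :: nat assume "?P c" "n \<in> {2..}"
      then show "?g n \<le> c" using iff[of n] by auto
    next
      fix n :: nat assume g: "\<forall>n\<in>{2..}. ?g n \<le> c" and "n \<ge> 1"
      show "real (f n) \<le> c * (real n - 1) + 1"
      proof (cases "n = 1")
        case True
        then show ?thesis using C[of 1] by simp
      next
        case False
        then have "n \<ge> 2" using \<open>n \<ge> 1\<close> by simp
        then show ?thesis using iff g by simp
      qed
    qed
  qed
  have "?P C" using C by blast
  then have bdd: "bdd_above (?g ` {2..})" unfolding P_iff by (intro bdd_aboveI2) auto
  have "?P m" unfolding P_iff m_def using bdd by (intro ballI cSUP_upper)
  moreover have "m \<le> c" if "?P c" for c
    using that unfolding P_iff m_def by (intro cSUP_least) auto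
  ultimately have "(LEAST c. ?P c) = m" by (rule Least_equality)
  then show ?thesis using \<open>?P m\<close> assms(2) by simp
qed

lemma eta_le_c_const:
  assumes "n \<ge> 1" "r \<ge> 1"
  shows "real (eta (cyclic_power n r)) \<le> c_const r * (real n - 1) + 1"
proof -
  obtain c where c: "\<And>n. n \<ge> 1 \<Longrightarrow> zs_bound (\<lambda>e. e \<le> n) n r (c * (n - 1) + 1)"
    using zs_bound_linear[of r] by blast
  have "real (eta (cyclic_power n r)) \<le> real c * (real n - 1) + 1" if "n \<ge> 1" for n
  proof -
    have "eta (cyclic_power n r) \<le> c * (n - 1) + 1"
      unfolding eta_altdef[OF that assms(2)] using c[OF that] by (intro Least_le) simp
    then have "real (eta (cyclic_power n r)) \<le> real (c * (n - 1) + 1)" by (simp only: of_nat_le_iff)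
    then show ?thesis using that by (simp add: of_nat_diff)
  qed
  then show ?thesis unfolding c_const_def using assms(1) by (rule least_slope)
qed

lemma greatest_primepow_decompose:
  assumes "n \<ge> 1"
  shows "\<exists>p k. prime p \<and> greatest_primepow n = p ^ k \<and> greatest_primepow n dvd n"
proof (cases "n = 1")
  case True
  then show ?thesis
    \<comment> \<open>The convention for \<open>n = 1\<close> is covered by the zeroth power of a
      prime.\<close>
    by (intro exI[of _ 2] exI[of _ 0]) (simp add: greatest_primepow_def)
next
  case False
  then obtain p where "prime p" "p dvd n" using prime_factor_nat by blast
  then have "p \<in> primepow_factors n"
    by (auto simp: primepow_factors_def)
  then have "greatest_primepow n \<in> primepow_factors n"
    using False assms finite_primepow_factors[of n] by (auto simp: greatest_primepow_def intro!: Max_in)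
  then show ?thesis by (auto simp: primepow_factors_def primepow_def)
qed

theorem theorem3:
  fixes n r :: nat
  assumes "n \<ge> 1" and "r \<ge> 1"
  shows "real (davenport (cyclic_power n r)) \<le>
    real r * (real n - 1) + 1 +
      (c_const r - real r) * (real n / real (greatest_primepow n) - 1)"
proof -
  define q where "q = greatest_primepow n"
  obtain p k where p: "prime p" and q: "q = p ^ k" and "q dvd n"
    using greatest_primepow_decompose[OF assms(1)] unfolding q_def by blast
  then obtain m where n: "n = m * q" by (metis dvd_def mult.commute)
  have pos: "m \<ge> 1" "q \<ge> 1" using assms(1) n by (auto intro: Suc_leI gr0I)
  \<comment> \<open>The first summand pays for \<open>r * (q - 1)\<close> extractions of at most
    \<open>m\<close> terms each, the second for the last one; Olson's theorem needs
    \<open>r * (q - 1) + 1\<close> vectors.\<close>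
  let ?t = "r * (q - 1) * m + eta (cyclic_power m r)"
  have "zs_bound (\<lambda>_. True) q r (Suc (r * (q - 1)))"
    using zs_bound_prime_power[OF p q] by simp
  with zs_bound_eta[OF pos(1) assms(2)] have zs: "zs_bound (\<lambda>_. True) n r ?t"
    unfolding n using pos(1) by (intro zs_bound_mult) auto
  \<comment> \<open>The definition of \<open>davenport\<close> asks for a positive length; a bound
    of 0 would give a nonempty subset of the empty set.\<close>
  have "?t \<ge> 1"
  proof (rule ccontr)
    assume "\<not> ?t \<ge> 1"
    then have "?t = 0" by linarith
    with zs have "zs_bound (\<lambda>_. True) n r 0" by (rule subst[rotated])
    from zs_boundD[OF this, of "{}"] show False by simp
  qed
  with zs have "real (davenport (cyclic_power n r)) \<le> real ?t"
    using davenport_le[OF assms(1)] by (simp only: of_nat_le_iff)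
  also have "\<dots> = real r * (real q - 1) * real m + real (eta (cyclic_power m r))"
    using pos by (simp add: of_nat_diff)
  also have "\<dots> \<le> real r * (real q - 1) * real m + (c_const r * (real m - 1) + 1)"
    using eta_le_c_const[OF pos(1) assms(2)] by simp
  also have "\<dots> = real r * (real n - 1) + 1 + (c_const r - real r) * (real m - 1)"
    by (simp add: n algebra_simps)
  also have "real m = real n / real q" using pos by (simp add: n)
  finally show ?thesis by (simp only: q_def)
qed

end
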